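(* Let $m\ge 1$ and let $F_{2m}$ be free with basis $x_1,\dots,x_{2m}$. Every $\Delta$-primitive element of $F_{2m}$ is the image of $u_{2m}=[x_1,x_2][x_3,x_4]\cdots[x_{2m-1},x_{2m}]$ under some automorphism of $F_{2m}$.
   Context: $F=F_n$ is free with basis $x_1,\dots,x_n$; $\mathbb{Z}F$ is its integral group ring, $\varepsilon:\mathbb{Z}F\to\mathbb{Z}$ the augmentation map and $\Delta=\ker\varepsilon$ the augmentation ideal. $\Delta$ is a free left $\mathbb{Z}F$-module with basis $x_1-1,\dots,x_n-1$; for $a\in\Delta$ the (left) Fox derivatives $d_i(a)\in\mathbb{Z}F$ are the unique elements with $a=\sum_{i=1}^n d_i(a)(x_i-1)$, extended to all of $\mathbb{Z}F$ by $d_i(a)=d_i(a-\varepsilon(a))$ (so $d_i(1)=0$). For $g\in F$ the Fox derivatives of $g$ are $d_1(g),\dots,d_n(g)$. An element $u\in F$ is called $\Delta$-primitive if $d_1(u),\dots,d_n(u)$ generate $\Delta$ as a right ideal of $\mathbb{Z}F$. $[a,b]=a^{-1}b^{-1}ab$. *)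

theory Defs
  imports "HOL-Algebra.Group" "HOL-Library.Function_Algebras"
begin

text \<open>A letter (i, False) stands for x_i, a letter (i, True) for x_i^{-1}.
  Generators are indexed 0..n-1 (paper: x_1..x_n, so x_k here is x_(k+1) there).\<close>

type_synonym letter = "nat \<times> bool"
type_synonym word = "letter list"

fun reduced :: "word \<Rightarrow> bool" where
  "reduced (a # b # w) = (\<not> (fst a = fst b \<and> snd a \<noteq> snd b) \<and> reduced (b # w))"
| "reduced _ = True"

fun red :: "word \<Rightarrow> word" where
  "red [] = []"
| "red (a # w) = (case red w of
       [] \<Rightarrow> [a]
     | b # w' \<Rightarrow> (if fst a = fst b \<and> snd a \<noteq> snd b then w' else a # b # w'))"

definition fw_mult :: "word \<Rightarrow> word \<Rightarrow> word" where
  "fw_mult u v = red (u @ v)"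

definition fw_inv :: "word \<Rightarrow> word" where
  "fw_inv u = rev (map (\<lambda>(i, b). (i, \<not> b)) u)"

definition free_grp :: "nat \<Rightarrow> word monoid" where
  "free_grp n = \<lparr> carrier = {w. reduced w \<and> (\<forall>l\<in>set w. fst l < n)},
                  mult = fw_mult, one = [] \<rparr>"

definition gen :: "nat \<Rightarrow> word" where
  "gen i = [(i, False)]"

definition fw_comm :: "word \<Rightarrow> word \<Rightarrow> word" where
  "fw_comm a b = fw_mult (fw_mult (fw_mult (fw_inv a) (fw_inv b)) a) b"

fun surface_word :: "nat \<Rightarrow> word" where
  "surface_word 0 = []"
| "surface_word (Suc k) = fw_mult (surface_word k) (fw_comm (gen (2 * k)) (gen (2 * k + 1)))"

type_synonym gring = "word \<Rightarrow> int"

definition supp :: "gring \<Rightarrow> word set" where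
  "supp a = {w. a w \<noteq> 0}"

definition ZF :: "nat \<Rightarrow> gring set" where
  "ZF n = {a. finite (supp a) \<and> supp a \<subseteq> carrier (free_grp n)}"

definition gr_mult :: "gring \<Rightarrow> gring \<Rightarrow> gring" where
  "gr_mult a b = (\<lambda>w. \<Sum>(u, v) \<in> supp a \<times> supp b.
                     if fw_mult u v = w then a u * b v else 0)"

definition gr_of :: "word \<Rightarrow> gring" where
  "gr_of g = (\<lambda>w. if w = g then 1 else 0)"

definition gr_one :: gring where
  "gr_one = gr_of []"

definition aug :: "gring \<Rightarrow> int" where
  "aug a = (\<Sum>w \<in> supp a. a w)"

definition Delta :: "nat \<Rightarrow> gring set" where
  "Delta n = {a \<in> ZF n. aug a = 0}"

definition fox_vec :: "nat \<Rightarrow> gring \<Rightarrow> (nat \<Rightarrow> gring)" where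
  "fox_vec n a = (THE ds. (\<forall>i<n. ds i \<in> ZF n) \<and> (\<forall>i\<ge>n. ds i = 0) \<and>
       a - of_int (aug a) * gr_one = (\<Sum>i<n. gr_mult (ds i) (gr_of (gen i) - gr_one)))"

definition fox :: "nat \<Rightarrow> nat \<Rightarrow> gring \<Rightarrow> gring" where
  "fox n i a = fox_vec n a i"

definition Delta_primitive :: "nat \<Rightarrow> word \<Rightarrow> bool" where
  "Delta_primitive n u \<longleftrightarrow> u \<in> carrier (free_grp n) \<and>
     Delta n = {\<Sum>i<n. gr_mult (fox n i (gr_of u)) (r i) | r. \<forall>i<n. r i \<in> ZF n}"

end

theory Submission
  imports Defs
begin

text \<open>Write \<open>T\<close> for the Cayley tree of \<open>F\<close>. A derivation \<open>F \<rightarrow> \<int>F\<close> is \<open>g \<mapsto> (g - 1) \<psi>\<close> for a function \<open>\<psi>\<close> on the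
  vertices of \<open>T\<close> that is locally constant near the ends, and \<open>\<Delta>\<close>-primitivity of \<open>u\<close> says that every
  element of \<open>\<Delta>\<close> is \<open>(u - 1) \<psi>\<close> for such a \<open>\<psi>\<close>. This is invariant under automorphisms, so \<open>u\<close> may be
  taken of minimal length in its orbit; then, by Whitehead's argument, the Whitehead graph of \<open>u\<close> is
  connected and has no cut vertex. Suppose that at least three translates of the axis of \<open>u\<close> cross an
  edge of \<open>T\<close>, and choose \<open>\<psi>\<close> that takes the same value at both ends of every translate except for two
  of these, where it changes by \<open>1\<close> and \<open>- 1\<close>. As there are no cut vertices, \<open>\<psi>\<close> is constant near the ends
  on each side of the edge, the third translate forces the two constants to be equal, and then \<open>\<psi>\<close>
  cannot change along the first translate. Hence each letter occurs exactly once in the cyclic word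
  \<open>u\<close>, and the classical reduction of surface words turns \<open>u\<close> into a product of commutators.\<close>

text \<open>The two inclusions in \<Delta>-primitivity do different work. That the right ideal lies
  in \<Delta> makes every exponent sum of \<open>u\<close> vanish, so a generator that occurs twice
  brings its inverse along; this is the third translate. It crosses the edge against the direction
  of the other two, so it contains no step at which \<psi> jumps. That the right ideal is all of
  \<Delta> yields \<psi>; as members of \<Delta> have augmentation 0, a jump of 1 has to be balanced
  by a jump of -1 elsewhere. Fox derivatives depend on the basis, so both facts are first moved to
  the predicate \<open>separating\<close>, which mentions only the group. Minimal length alone does
  not make the Whitehead graph connected: a generator absent from \<open>u\<close> would give
  isolated vertices. That every generator occurs is therefore proved separately. It is used again at
  the end, where the reduction of surface words may have cancelled letters: all \<open>n\<close>
  generators must still occur, and this fixes the number of commutators.\<close>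

definition linv :: "letter \<Rightarrow> letter" where
  "linv l = (fst l, \<not> snd l)"

lemma linv_linv [simp]: "linv (linv l) = l"
  by (simp add: linv_def)

lemma fst_linv [simp]: "fst (linv l) = fst l"
  by (simp add: linv_def)

lemma snd_linv [simp]: "snd (linv l) \<longleftrightarrow> \<not> snd l"
  by (simp add: linv_def)

lemma linv_neq [simp]: "linv l \<noteq> l" "l \<noteq> linv l"
  by (auto simp: linv_def prod_eq_iff)

lemma linv_inject [simp]: "linv a = linv b \<longleftrightarrow> a = b"
  by (auto simp: linv_def prod_eq_iff)

lemma linv_eq_iff: "linv a = b \<longleftrightarrow> a = linv b"
  by auto

lemma linv_pair [simp]: "linv (i, b) = (i, \<not> b)"
  by (simp add: linv_def)

lemma eq_linv_iff: "fst a = fst b \<and> snd a \<noteq> snd b \<longleftrightarrow> b = linv a"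
  by (auto simp: linv_def prod_eq_iff)

lemma fst_eq_iff: "fst a = fst b \<longleftrightarrow> b = a \<or> b = linv a"
  by (auto simp: linv_def prod_eq_iff)

lemma reduced_Cons2 [simp]: "reduced (a # b # w) \<longleftrightarrow> b \<noteq> linv a \<and> reduced (b # w)"
  by (simp only: reduced.simps eq_linv_iff)

declare reduced.simps(1) [simp del]

lemma reduced_Cons: "reduced (a # w) \<longleftrightarrow> reduced w \<and> (w = [] \<or> hd w \<noteq> linv a)"
  by (cases w) auto

lemma reduced_append:
  "reduced (u @ v) \<longleftrightarrow> reduced u \<and> reduced v \<and> (u = [] \<or> v = [] \<or> hd v \<noteq> linv (last u))"
proof (induction u)
  case (Cons a u)
  then show ?case by (cases u) (auto simp: reduced_Cons)
qed simp

lemma red_Cons: "red (a # w) = (case red w of [] \<Rightarrow> [a] | b # w' \<Rightarrow> if b = linv a then w' else a # b # w')"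
  unfolding red.simps eq_linv_iff ..

declare red.simps(2) [simp del]

lemma reduced_red [simp]: "reduced (red w)"
proof (induction w)
  case (Cons a w)
  then show ?case
    by (auto simp: red_Cons reduced_Cons split: list.split)
qed simp

lemma red_reduced [simp]: "reduced w \<Longrightarrow> red w = w"
proof (induction w)
  case (Cons a w)
  then show ?case
    by (cases w) (auto simp: red_Cons)
qed simp

lemma set_red: "set (red w) \<subseteq> set w"
  by (induction w) (auto simp: red_Cons split: list.splits if_splits)

lemma length_red: "length (red w) \<le> length w"
  by (induction w) (auto simp: red_Cons split: list.splits if_splits)

lemma red_append_right [simp]: "red (u @ red v) = red (u @ v)"
  by (induction u) (auto simp: red_Cons)

text \<open>If \<open>red w\<close> begins with \<open>a\<close>, prefixing \<open>linv a\<close>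
  strips that letter and prefixing \<open>a\<close> puts it back; a further cancellation is
  impossible because \<open>red w\<close> is reduced.\<close>

lemma red_cancel_Cons [simp]: "red (a # linv a # w) = red w"
proof (cases "red w")
  case (Cons b w')
  have "reduced (b # w')" using reduced_red[of w] Cons by simp
  then show ?thesis using Cons
    by (auto simp: red_Cons reduced_Cons split: list.split)
qed (simp add: red_Cons)

lemma red_cancel_Cons' [simp]: "red (linv a # a # w) = red w"
  using red_cancel_Cons[of "linv a" w] by simp

lemma red_Cons_red [simp]: "red (a # red w) = red (a # w)"
  by (simp add: red_Cons)

lemma red_append_left [simp]: "red (red u @ v) = red (u @ v)"
proof (induction u)
  case (Cons a u)
  have *: "red (a # u @ v) = red (a # red u @ v)"
    using Cons red_Cons_red by metis
  show ?case
  proof (cases "red u")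
    case Nil
    then show ?thesis using * by (simp add: red_Cons)
  next
    case (Cons b w)
    show ?thesis
    proof (cases "b = linv a")
      case True
      then show ?thesis using * Cons by (simp add: red_Cons[of a u])
    next
      case False
      then show ?thesis using * Cons by (simp add: red_Cons[of a u])
    qed
  qed
qed simp

definition winv :: "word \<Rightarrow> word" where
  "winv w = rev (map linv w)"

lemma fw_inv_eq: "fw_inv = winv"
  by (auto simp: fw_inv_def winv_def fun_eq_iff linv_def split_def)

lemma winv_simps [simp]:
  "winv [] = []" "winv (a # w) = winv w @ [linv a]" "winv (u @ v) = winv v @ winv u"
  "winv (winv w) = w" "length (winv w) = length w" "winv w = [] \<longleftrightarrow> w = []"
  by (auto simp: winv_def rev_map comp_def)

lemma set_winv: "set (winv w) = linv ` set w"
  by (simp add: winv_def)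

lemma hd_winv: "w \<noteq> [] \<Longrightarrow> hd (winv w) = linv (last w)"
  by (simp add: winv_def hd_rev last_map)

lemma last_winv: "w \<noteq> [] \<Longrightarrow> last (winv w) = linv (hd w)"
  by (simp add: winv_def last_rev hd_map)

lemma reduced_winv [simp]: "reduced (winv w) \<longleftrightarrow> reduced w"
proof -
  have *: "reduced (winv w)" if "reduced w" for w
    using that
  proof (induction w)
    case (Cons a w)
    then show ?case by (auto simp: reduced_append reduced_Cons last_winv)
  qed simp
  show ?thesis using *[of w] *[of "winv w"] by auto
qed

lemma red_winv_cancel: "red (winv w @ w @ z) = red z"
proof (induction w arbitrary: z)
  case (Cons a w)
  have "red (winv w @ linv a # a # w @ z) = red (winv w @ red (linv a # a # w @ z))"
    by (simp only: red_append_right)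
  then show ?case using Cons by simp
qed simp

lemma red_winv_cancel': "red (w @ winv w @ z) = red z"
  using red_winv_cancel[of "winv w"] by simp

lemma red_winv_end [simp]:
  "red (winv w @ w) = []" "red (w @ winv w) = []"
  "red (y @ winv w @ w) = red y" "red (y @ w @ winv w) = red y"
proof -
  show *: "red (winv w @ w) = []" "red (w @ winv w) = []" for w
    using red_winv_cancel[of w "[]"] red_winv_cancel'[of w "[]"] by simp_all
  show "red (y @ winv w @ w) = red y" "red (y @ w @ winv w) = red y"
    using red_append_right[of y "winv w @ w"] red_append_right[of y "w @ winv w"] by (simp_all add: *)
qed

text \<open>Rewriting with these rules pushes \<^const>\<open>red\<close> to the right through a product
  and thereby cancels inverse factors in the middle of a word.\<close>

lemma red_to_mult: "red (x @ y) = fw_mult x (red y)"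
  by (simp add: fw_mult_def)

lemma red_to_mult_Cons: "red (a # y) = fw_mult [a] (red y)"
  by (simp add: fw_mult_def)

lemma mult_cancel:
  "fw_mult x (fw_mult (winv x) (red z)) = red z"
  "fw_mult (winv x) (fw_mult x (red z)) = red z"
  "fw_mult x (fw_mult (winv x) (fw_mult y z)) = fw_mult y z"
  "fw_mult (winv x) (fw_mult x (fw_mult y z)) = fw_mult y z"
  "fw_mult [a] (fw_mult [linv a] (red z)) = red z"
  "fw_mult [linv a] (fw_mult [a] (red z)) = red z"
  "fw_mult [a] (fw_mult [linv a] (fw_mult y z)) = fw_mult y z"
  "fw_mult [linv a] (fw_mult [a] (fw_mult y z)) = fw_mult y z"
  "fw_mult x (winv x) = []" "fw_mult (winv x) x = []"
  "fw_mult [] (red z) = red z" "fw_mult [] (fw_mult y z) = fw_mult y z"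
  by (simp_all add: fw_mult_def red_winv_cancel red_winv_cancel')

lemma mult_assoc: "fw_mult (fw_mult x y) z = fw_mult x (fw_mult y z)"
  by (simp add: fw_mult_def)

lemmas word_simps = red_to_mult red_to_mult_Cons mult_cancel mult_assoc

lemma red_cong_right: "red y = red y' \<Longrightarrow> red (x @ y) = red (x @ y')"
  by (metis red_append_right)

lemma red_cong_left: "red x = red x' \<Longrightarrow> red (x @ y) = red (x' @ y)"
  by (metis red_append_left)

section \<open>The free group on reduced words\<close>

abbreviation Lt :: "nat \<Rightarrow> letter set" where
  "Lt n \<equiv> {l. fst l < n}"

abbreviation C :: "nat \<Rightarrow> word set" where
  "C n \<equiv> carrier (free_grp n)"

lemma carrier_iff: "w \<in> C n \<longleftrightarrow> reduced w \<and> set w \<subseteq> Lt n"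
  by (auto simp: free_grp_def)

lemma free_grp_mult [simp]: "mult (free_grp n) = fw_mult"
  and free_grp_one [simp]: "one (free_grp n) = []"
  by (simp_all add: free_grp_def)

lemma red_carrier: "set w \<subseteq> Lt n \<Longrightarrow> red w \<in> C n"
  using set_red[of w] by (auto simp: carrier_iff)

lemma mult_carrier [simp]: "u \<in> C n \<Longrightarrow> v \<in> C n \<Longrightarrow> fw_mult u v \<in> C n"
  unfolding fw_mult_def by (rule red_carrier) (auto simp: carrier_iff)

lemma winv_carrier [simp]: "u \<in> C n \<Longrightarrow> winv u \<in> C n"
  by (auto simp: carrier_iff set_winv)

lemma Nil_carrier [simp]: "[] \<in> C n"
  by (simp add: carrier_iff)

lemma group_free_grp: "group (free_grp n)"
proof (rule groupI)
  fix x assume "x \<in> C n"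
  then show "\<exists>y\<in>C n. y \<otimes>\<^bsub>free_grp n\<^esub> x = \<one>\<^bsub>free_grp n\<^esub>"
    by (intro bexI[of _ "winv x"]) (auto simp: mult_cancel)
qed (auto simp: mult_assoc, auto simp: fw_mult_def carrier_iff)

lemma mult_Nil [simp]: "x \<in> C n \<Longrightarrow> fw_mult x [] = x" "x \<in> C n \<Longrightarrow> fw_mult [] x = x"
  by (auto simp: fw_mult_def carrier_iff)

lemma mult_cancel_carrier:
  "z \<in> C n \<Longrightarrow> fw_mult x (fw_mult (winv x) z) = z"
  "z \<in> C n \<Longrightarrow> fw_mult (winv x) (fw_mult x z) = z"
  "z \<in> C n \<Longrightarrow> fw_mult (fw_mult z x) (winv x) = z"
  "z \<in> C n \<Longrightarrow> fw_mult (fw_mult z (winv x)) x = z"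
  using mult_cancel(1,2)[of x z] by (auto simp: carrier_iff mult_assoc mult_cancel fw_mult_def)

lemma winv_mult: "winv (fw_mult x y) = fw_mult (winv y) (winv x)"
proof -
  define z where "z = fw_mult x y"
  have "fw_mult (fw_mult (winv y) (winv x)) z = []"
    using red_append_right[of "winv y" "winv x @ x @ y"]
    by (simp add: z_def fw_mult_def red_winv_cancel)
  then have "fw_mult (fw_mult (fw_mult (winv y) (winv x)) z) (winv z) = fw_mult [] (winv z)"
    by simp
  moreover have "fw_mult [] (winv z) = winv z"
    by (simp add: fw_mult_def z_def)
  moreover have "fw_mult (fw_mult (fw_mult (winv y) (winv x)) z) (winv z) = fw_mult (winv y) (winv x)"
    using red_winv_end(4)[of "winv y @ winv x" z] by (simp add: fw_mult_def)
  ultimately show ?thesis by (simp add: z_def)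
qed

section \<open>Substitutions\<close>

definition subst :: "(letter \<Rightarrow> word) \<Rightarrow> word \<Rightarrow> word" where
  "subst s w = red (concat (map s w))"

text \<open>The condition on inverses ranges over all letters, so that \<open>subst\<close> is
  compatible with \<open>red\<close> on every word; only the range condition depends on
  \<open>n\<close>.\<close>

definition ok_subst :: "nat \<Rightarrow> (letter \<Rightarrow> word) \<Rightarrow> bool" where
  "ok_subst n s \<longleftrightarrow> (\<forall>l. s (linv l) = winv (s l)) \<and> (\<forall>l\<in>Lt n. set (s l) \<subseteq> Lt n)"

lemma ok_substD:
  "ok_subst n s \<Longrightarrow> s (linv l) = winv (s l)"
  "ok_subst n s \<Longrightarrow> l \<in> Lt n \<Longrightarrow> set (s l) \<subseteq> Lt n"
  unfolding ok_subst_def by blast+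

lemma subst_red: 
  assumes "\<And>l. s (linv l) = winv (s l)"
  shows "subst s (red w) = subst s w"
proof (induction w)
  case (Cons a w)
  have *: "subst s (a # red w) = subst s (a # w)"
    using Cons by (metis concat.simps(2) list.simps(9) red_append_right subst_def)
  show ?case
  proof (cases "\<exists>w'. red w = linv a # w'")
    case True
    then obtain w' where w': "red w = linv a # w'" by blast
    have "subst s (a # red w) = subst s w'"
      by (simp add: w' subst_def assms red_winv_cancel')
    then show ?thesis using * w' by (simp add: red_Cons)
  next
    case False
    then have "red (a # w) = a # red w"
      by (auto simp: red_Cons split: list.split)
    then show ?thesis using * by simp
  qed
qed simp

lemma subst_append: "subst s (u @ v) = fw_mult (subst s u) (subst s v)"
  by (simp add: subst_def fw_mult_def)

lemma subst_Cons: "subst s (a # v) = fw_mult (s a) (subst s v)"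
  by (simp add: subst_def fw_mult_def)

lemma subst_mult:
  assumes "ok_subst n s"
  shows "subst s (fw_mult u v) = fw_mult (subst s u) (subst s v)"
  unfolding fw_mult_def[of u v] using subst_red[of s "u @ v"] ok_substD(1)[OF assms]
  by (simp add: subst_append)

lemma subst_carrier: "ok_subst n s \<Longrightarrow> set w \<subseteq> Lt n \<Longrightarrow> subst s w \<in> C n"
  unfolding subst_def ok_subst_def by (rule red_carrier) fastforce

lemma subst_subst:
  assumes "ok_subst n s" "ok_subst n t" "\<And>l. l \<in> Lt n \<Longrightarrow> subst t (s l) = [l]" "w \<in> C n"
  shows "subst t (subst s w) = w"
proof -
  have "subst t (subst s w) = red w" if "set w \<subseteq> Lt n" for w
    using that
  proof (induction w)
    case Nil
    then show ?case by (simp add: subst_def)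
  next
    case (Cons a w)
    then show ?case
      by (simp add: subst_Cons[of s] subst_mult[OF assms(2)] assms(3)) (simp add: fw_mult_def)
  qed
  then show ?thesis using assms(4) by (simp add: carrier_iff)
qed

lemma subst_iso:
  assumes "ok_subst n s" "ok_subst n t"
    and "\<And>l. l \<in> Lt n \<Longrightarrow> subst t (s l) = [l]" "\<And>l. l \<in> Lt n \<Longrightarrow> subst s (t l) = [l]"
  shows "subst s \<in> iso (free_grp n) (free_grp n)"
proof -
  have C: "subst s w \<in> C n" if "ok_subst n s" "w \<in> C n" for s w
    using subst_carrier[OF that(1)] that(2) by (simp add: carrier_iff)
  have "bij_betw (subst s) (C n) (C n)"
    by (rule bij_betw_byWitness[where f' = "subst t"])
      (use assms subst_subst[of n s t] subst_subst[of n t s] C in blast)+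
  then show ?thesis
    using C[OF assms(1)] subst_mult[OF assms(1)] by (simp add: iso_def hom_def)
qed

text \<open>A product of Nielsen transvections when \<open>P\<close> and \<open>Q\<close> do not
  involve \<open>a\<close>.\<close>

definition elem_subst :: "letter \<Rightarrow> word \<Rightarrow> word \<Rightarrow> letter \<Rightarrow> word" where
  "elem_subst a P Q l = (if l = a then P @ [a] @ Q else if l = linv a then winv Q @ [linv a] @ winv P else [l])"

lemma elem_subst_ok:
  assumes "a \<in> Lt n" "set P \<subseteq> Lt n" "set Q \<subseteq> Lt n"
  shows "ok_subst n (elem_subst a P Q)"
proof -
  have "elem_subst a P Q (linv l) = winv (elem_subst a P Q l)" for l
    by (cases "l = a"; cases "l = linv a") (auto simp: elem_subst_def linv_eq_iff[of _ a])
  moreover have "set (elem_subst a P Q l) \<subseteq> Lt n" if "l \<in> Lt n" for l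
    using assms that by (auto simp: elem_subst_def set_winv)
  ultimately show ?thesis unfolding ok_subst_def by blast
qed

lemma subst_elem_fix:
  assumes "fst a \<notin> fst ` set w"
  shows "concat (map (elem_subst a P Q) w) = w"
  using assms by (induction w) (auto simp: elem_subst_def)

text \<open>As \<open>P\<close> and \<open>Q\<close> avoid \<open>a\<close>, the substitution fixes
  them, so the one built from \<open>winv P\<close> and \<open>winv Q\<close> undoes it on either
  side.\<close>

lemma elem_subst_iso:
  assumes "a \<in> Lt n" "set P \<subseteq> Lt n" "set Q \<subseteq> Lt n" "fst a \<notin> fst ` set P" "fst a \<notin> fst ` set Q"
  shows "subst (elem_subst a P Q) \<in> iso (free_grp n) (free_grp n)"
proof -
  have fst_winv: "fst ` set (winv w) = fst ` set w" for w
    by (force simp: set_winv image_image)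
  have 1: "subst (elem_subst a P Q) (elem_subst a (winv P) (winv Q) l) = [l]"
    if "fst a \<notin> fst ` set P" "fst a \<notin> fst ` set Q" for P Q l
  proof -
    consider "l = a" | "l = linv a" | "l \<noteq> a" "l \<noteq> linv a" by blast
    then show ?thesis
    proof cases
      case 1
      then show ?thesis using that
        by (simp add: subst_def elem_subst_def[of a "winv P"] subst_elem_fix fst_winv)
          (simp add: elem_subst_def word_simps, simp add: fw_mult_def)
    next
      case 2
      then show ?thesis using that
        by (simp add: subst_def elem_subst_def[of a "winv P"] subst_elem_fix fst_winv)
          (simp add: elem_subst_def word_simps, simp add: fw_mult_def)
    next
      case 3
      then show ?thesis by (simp add: elem_subst_def subst_def)
    qed
  qed
  have W: "set (winv w) \<subseteq> Lt n" if "set w \<subseteq> Lt n" for w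
    using that by (auto simp: set_winv)
  show ?thesis
    using assms(2,3)
    by (intro subst_iso[where t = "elem_subst a (winv P) (winv Q)"])
      (use assms 1[of P Q] 1[of "winv P" "winv Q"] W in \<open>simp_all add: elem_subst_ok fst_winv\<close>)
qed

section \<open>Fox derivatives\<close>

lemma sum_fun_apply: "(\<Sum>i\<in>A. f i) x = (\<Sum>i\<in>A. f i x)"
  for f :: "'i \<Rightarrow> 'x \<Rightarrow> 'v::comm_monoid_add"
  by (induction A rule: infinite_finite_induct) auto

lemma ZF_iff: "a \<in> ZF n \<longleftrightarrow> finite (supp a) \<and> supp a \<subseteq> C n"
  by (simp add: ZF_def)

lemma supp_iff: "w \<in> supp a \<longleftrightarrow> a w \<noteq> 0"
  by (simp add: supp_def)

lemma ZF_I: "finite A \<Longrightarrow> A \<subseteq> C n \<Longrightarrow> (\<And>w. w \<notin> A \<Longrightarrow> a w = 0) \<Longrightarrow> a \<in> ZF n"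
proof -
  assume A: "finite A" "A \<subseteq> C n" and 0: "\<And>w. w \<notin> A \<Longrightarrow> a w = 0"
  have "supp a \<subseteq> A" using 0 by (auto simp: supp_def)
  then show ?thesis using A finite_subset by (auto simp: ZF_iff)
qed

lemma ZF_outside: "a \<in> ZF n \<Longrightarrow> w \<notin> C n \<Longrightarrow> a w = 0"
  by (auto simp: ZF_iff supp_def)

lemma ZF_uminus: "a \<in> ZF n \<Longrightarrow> - a \<in> ZF n"
  by (rule ZF_I[of "supp a"]) (auto simp: ZF_iff supp_iff)

lemma ZF_add: "a \<in> ZF n \<Longrightarrow> b \<in> ZF n \<Longrightarrow> a + b \<in> ZF n"
  by (rule ZF_I[of "supp a \<union> supp b"]) (auto simp: ZF_iff supp_iff)

lemma ZF_diff: "a \<in> ZF n \<Longrightarrow> b \<in> ZF n \<Longrightarrow> a - b \<in> ZF n"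
  by (rule ZF_I[of "supp a \<union> supp b"]) (auto simp: ZF_iff supp_iff)

lemma ZF_0 [simp]: "0 \<in> ZF n"
  by (rule ZF_I[of "{}"]) auto

lemma ZF_sum: "(\<And>i. i \<in> A \<Longrightarrow> f i \<in> ZF n) \<Longrightarrow> (\<Sum>i\<in>A. f i) \<in> ZF n"
  by (induction A rule: infinite_finite_induct) (auto intro: ZF_add)

lemma ZF_gr_of: "g \<in> C n \<Longrightarrow> gr_of g \<in> ZF n"
  by (rule ZF_I[of "{g}"]) (auto simp: gr_of_def)

lemma aug_eq: "finite A \<Longrightarrow> supp a \<subseteq> A \<Longrightarrow> aug a = (\<Sum>w\<in>A. a w)"
  unfolding aug_def by (rule sum.mono_neutral_left) (auto simp: supp_iff)

lemma mult_eq_iff_left: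
  assumes "u \<in> C n" "v \<in> C n" "w \<in> C n"
  shows "fw_mult u v = w \<longleftrightarrow> v = fw_mult (winv u) w"
  using assms mult_cancel_carrier by metis

lemma mult_eq_iff_right:
  assumes "u \<in> C n" "v \<in> C n" "w \<in> C n"
  shows "fw_mult u v = w \<longleftrightarrow> u = fw_mult w (winv v)"
  using assms mult_cancel_carrier by metis

lemma gr_mult_left:
  assumes a: "a \<in> ZF n" and b: "b \<in> ZF n" and w: "w \<in> C n"
    and A: "finite A" "supp a \<subseteq> A"
  shows "gr_mult a b w = (\<Sum>u\<in>A. a u * b (fw_mult (winv u) w))"
proof -
  have fin: "finite (supp b)" using b by (simp add: ZF_iff)
  have "gr_mult a b w = (\<Sum>u\<in>supp a. \<Sum>v\<in>supp b. if fw_mult u v = w then a u * b v else 0)"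
    by (simp add: gr_mult_def sum.cartesian_product)
  also have "\<dots> = (\<Sum>u\<in>supp a. \<Sum>v\<in>supp b. if v = fw_mult (winv u) w then a u * b v else 0)"
    using a b w by (intro sum.cong refl) (auto simp: ZF_iff mult_eq_iff_left[of _ n] subset_iff)
  also have "\<dots> = (\<Sum>u\<in>supp a. a u * b (fw_mult (winv u) w))"
    using fin by (intro sum.cong refl) (simp add: sum.delta' sum.delta supp_iff)
  also have "\<dots> = (\<Sum>u\<in>A. a u * b (fw_mult (winv u) w))"
    by (rule sum.mono_neutral_left) (use A in \<open>auto simp: supp_iff\<close>)
  finally show ?thesis .
qed

lemma gr_mult_right:
  assumes a: "a \<in> ZF n" and b: "b \<in> ZF n" and w: "w \<in> C n"
    and B: "finite B" "supp b \<subseteq> B"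
  shows "gr_mult a b w = (\<Sum>v\<in>B. a (fw_mult w (winv v)) * b v)"
proof -
  have fin: "finite (supp a)" using a by (simp add: ZF_iff)
  have "gr_mult a b w = (\<Sum>u\<in>supp a. \<Sum>v\<in>supp b. if fw_mult u v = w then a u * b v else 0)"
    by (simp add: gr_mult_def sum.cartesian_product)
  also have "\<dots> = (\<Sum>v\<in>supp b. \<Sum>u\<in>supp a. if fw_mult u v = w then a u * b v else 0)"
    by (rule sum.swap)
  also have "\<dots> = (\<Sum>v\<in>supp b. \<Sum>u\<in>supp a. if u = fw_mult w (winv v) then a u * b v else 0)"
    using a b w by (intro sum.cong refl) (auto simp: ZF_iff mult_eq_iff_right[of _ n] subset_iff)
  also have "\<dots> = (\<Sum>v\<in>supp b. a (fw_mult w (winv v)) * b v)"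
    using fin by (intro sum.cong refl) (simp add: sum.delta' sum.delta supp_iff)
  also have "\<dots> = (\<Sum>v\<in>B. a (fw_mult w (winv v)) * b v)"
    by (rule sum.mono_neutral_left) (use B in \<open>auto simp: supp_iff\<close>)
  finally show ?thesis .
qed

lemma gr_mult_outside:
  assumes "a \<in> ZF n" "b \<in> ZF n" "w \<notin> C n"
  shows "gr_mult a b w = 0"
  unfolding gr_mult_def
  by (rule sum.neutral) (use assms mult_carrier[of _ n] in \<open>auto simp: ZF_iff subset_iff\<close>)

lemma gen_carrier: "i < n \<Longrightarrow> gen i \<in> C n"
  by (simp add: gen_def carrier_iff)

lemma gr_mult_gen:
  assumes "a \<in> ZF n" "i < n" "w \<in> C n"
  shows "gr_mult a (gr_of (gen i) - gr_one) w = a (fw_mult w [(i, True)]) - a w"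
proof -
  have b: "gr_of (gen i) - gr_one \<in> ZF n"
    using assms(2) by (auto simp: gr_one_def intro!: ZF_diff ZF_gr_of gen_carrier)
  have "gr_mult a (gr_of (gen i) - gr_one) w
      = (\<Sum>v\<in>{gen i, []}. a (fw_mult w (winv v)) * (gr_of (gen i) - gr_one) v)"
    by (rule gr_mult_right[OF assms(1) b assms(3)]) (auto simp: supp_iff gr_of_def gr_one_def split: if_splits)
  also have "\<dots> = a (fw_mult w [(i, True)]) - a w"
    using assms by (simp add: gr_of_def gr_one_def gen_def)
  finally show ?thesis .
qed

text \<open>The contribution of one letter under the product rule. The derivative of
  \<open>x\<inverse>\<close> is \<open>- x\<inverse>\<close>, hence the longer prefix for inverse
  letters.\<close>

definition fox_term :: "nat \<Rightarrow> word \<Rightarrow> nat \<Rightarrow> gring" where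
  "fox_term i u k = (if fst (u ! k) = i then
      (if snd (u ! k) then - gr_of (take (Suc k) u) else gr_of (take k u)) else 0)"

definition fox_sum :: "nat \<Rightarrow> word \<Rightarrow> gring" where
  "fox_sum i u = (\<Sum>k<length u. fox_term i u k)"

lemma take_carrier: "u \<in> C n \<Longrightarrow> take k u \<in> C n"
  using reduced_append[of "take k u" "drop k u"] by (auto simp: carrier_iff dest: in_set_takeD)

lemma fox_sum_ZF: "u \<in> C n \<Longrightarrow> fox_sum i u \<in> ZF n"
  unfolding fox_sum_def fox_term_def
  by (intro ZF_sum) (auto intro!: ZF_uminus ZF_gr_of take_carrier)

lemma fox_sum_snoc:
  "fox_sum i (u @ [l]) = fox_sum i u +
     (if fst l = i then (if snd l then - gr_of (u @ [l]) else gr_of u) else 0)"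
proof -
  have "(\<Sum>k<length u. fox_term i (u @ [l]) k) = (\<Sum>k<length u. fox_term i u k)"
    by (rule sum.cong) (auto simp: fox_term_def nth_append)
  then show ?thesis by (simp add: fox_sum_def) (simp add: fox_term_def)
qed

text \<open>The fundamental formula of Fox calculus, read coefficient by coefficient: a right factor
  \<open>x_i - 1\<close> turns the coefficient at \<open>w\<close> into the difference of those at
  \<open>w x_i\<inverse>\<close> and \<open>w\<close>.\<close>

lemma fox_sum_telescope:
  assumes "u \<in> C n" "w \<in> C n"
  shows "(\<Sum>i<n. fox_sum i u (fw_mult w [(i, True)]) - fox_sum i u w) = gr_of u w - gr_one w"
  using assms(1)
proof (induction u rule: rev_induct)
  case Nil
  then show ?case by (simp add: fox_sum_def gr_one_def)
next
  case (snoc l u)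
  obtain j b where l: "l = (j, b)" by (cases l)
  have j: "j < n" and u: "u \<in> C n" "[l] \<in> C n"
    using snoc.prems by (auto simp: carrier_iff reduced_append l)
  have ul: "u @ [l] = fw_mult u [l]"
    using snoc.prems by (simp add: fw_mult_def carrier_iff)
  let ?t = "\<lambda>i. if fst l = i then (if snd l then - gr_of (u @ [l]) else gr_of u) else 0"
  have "(\<Sum>i<n. fox_sum i (u @ [l]) (fw_mult w [(i, True)]) - fox_sum i (u @ [l]) w)
      = (\<Sum>i<n. (fox_sum i u (fw_mult w [(i, True)]) - fox_sum i u w)
          + (if i = j then (?t j (fw_mult w [(j, True)]) - ?t j w) else 0))"
    by (intro sum.cong) (auto simp: fox_sum_snoc l)
  also have "\<dots> = gr_of u w - gr_one w + (?t j (fw_mult w [(j, True)]) - ?t j w)"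
    using snoc.IH[OF u(1)] j by (simp add: sum.distrib)
  also have "\<dots> = gr_of (u @ [l]) w - gr_one w"
  proof (cases b)
    case True
    have "fw_mult w [(j, True)] = u @ [l] \<longleftrightarrow> w = u"
    proof
      assume "fw_mult w [(j, True)] = u @ [l]"
      then show "w = u"
        using mult_cancel_carrier(3)[OF assms(2), of "[l]"] mult_cancel_carrier(3)[OF u(1), of "[l]"]
        by (metis l linv_pair True ul winv_simps(1,2) append_Nil)
    qed (use ul l True in simp)
    then show ?thesis using l True by (auto simp: gr_of_def)
  next
    case False
    have "fw_mult w [(j, True)] = u \<longleftrightarrow> w = u @ [l]"
      using mult_eq_iff_right[OF u(1,2) assms(2)] unfolding ul using l False by auto
    then show ?thesis using l False by (auto simp: gr_of_def)
  qed
  finally show ?case .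
qed

text \<open>Linear independence of the elements \<open>x_i - 1\<close>. Take a longest word
  \<open>g\<close> in the supports. A nonzero coefficient of \<open>e k\<close> at \<open>g\<close>
  would survive at the longer word \<open>g x_k\<close> unless \<open>g\<close> ends in the inverse
  of \<open>x_k\<close>. So only one index is left at \<open>g\<close>, and at \<open>g\<close>
  itself nothing can cancel its coefficient.\<close>

lemma fox_unique:
  assumes e: "\<And>i. i < n \<Longrightarrow> e i \<in> ZF n"
    and 0: "\<And>w. w \<in> C n \<Longrightarrow> (\<Sum>i<n. e i (fw_mult w [(i, True)]) - e i w) = 0"
    and "i < n"
  shows "e i = 0"
proof (rule ccontr)
  assume ne: "e i \<noteq> 0"
  define S where "S = (\<Union>i<n. supp (e i))"
  have fin: "finite S" using e by (auto simp: S_def ZF_iff)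
  have "S \<noteq> {}" using ne \<open>i < n\<close> by (auto simp: S_def supp_def fun_eq_iff)
  define M where "M = Max (length ` S)"
  have le: "length g \<le> M" if "g \<in> S" for g
    using that fin by (simp add: M_def)
  have vanish: "e j g = 0" if "M < length g" "j < n" for j g
    using le[of g] that by (auto simp: S_def supp_iff)
  have "M \<in> length ` S" using fin \<open>S \<noteq> {}\<close> by (simp add: M_def)
  then obtain j g where j: "j < n" "e j g \<noteq> 0" and M: "length g = M"
    by (auto simp: S_def supp_iff)
  have gC: "g \<in> C n" using ZF_outside[OF e[OF j(1)]] j(2) by auto
  have last: "g \<noteq> [] \<and> last g = (k, True)" if k: "k < n" "e k g \<noteq> 0" for k
  proof (rule ccontr)
    assume neg: "\<not> (g \<noteq> [] \<and> last g = (k, True))"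
    define w where "w = g @ [(k, False)]"
    have "reduced w"
      using neg gC by (cases "last g") (auto simp: w_def reduced_append carrier_iff)
    then have w: "w \<in> C n" using gC k by (auto simp: w_def carrier_iff)
    have lw: "M < length w" using M by (simp add: w_def)
    have "e h (fw_mult w [(h, True)]) - e h w = (if h = k then e k g else 0)" if "h < n" for h
    proof (cases "h = k")
      case True
      have "fw_mult w [(k, True)] = g"
        using red_winv_end(4)[of g "[(k, False)]"] gC by (simp add: fw_mult_def w_def carrier_iff)
      then show ?thesis using True vanish[OF lw k(1)] by simp
    next
      case False
      have "fw_mult w [(h, True)] = w @ [(h, True)]"
        using \<open>reduced w\<close> False unfolding fw_mult_def
        by (intro red_reduced) (auto simp: reduced_append w_def)
      then show ?thesis using False vanish[OF _ that] lw by simp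
    qed
    then have "(\<Sum>h<n. e h (fw_mult w [(h, True)]) - e h w) = (\<Sum>h<n. if h = k then e k g else 0)"
      by (intro sum.cong) auto
    then show False using 0[OF w] k by simp
  qed
  have g: "g \<noteq> []" "last g = (j, True)" using last[OF j] by auto
  have "e h (fw_mult g [(h, True)]) - e h g = (if h = j then - e j g else 0)" if "h < n" for h
  proof -
    have "fw_mult g [(h, True)] = g @ [(h, True)]"
      using gC g unfolding fw_mult_def
      by (intro red_reduced) (auto simp: reduced_append carrier_iff)
    then have "e h (fw_mult g [(h, True)]) = 0" using vanish[OF _ that] M by simp
    then show ?thesis using last[OF that] g by auto
  qed
  then have "(\<Sum>h<n. e h (fw_mult g [(h, True)]) - e h g) = (\<Sum>h<n. if h = j then - e j g else 0)"
    by (intro sum.cong) auto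
  then show False using 0[OF gC] j by simp
qed

lemma aug_gr_of [simp]: "aug (gr_of u) = 1"
  using aug_eq[of "{u}" "gr_of u"] by (simp add: supp_def gr_of_def)

lemma fox_eq:
  assumes u: "u \<in> C n" and i: "i < n"
  shows "fox n i (gr_of u) = fox_sum i u"
proof -
  define P where "P ds \<longleftrightarrow> (\<forall>i<n. ds i \<in> ZF n) \<and> (\<forall>i\<ge>n. ds i = 0) \<and>
       gr_of u - of_int (aug (gr_of u)) * gr_one = (\<Sum>i<n. gr_mult (ds i) (gr_of (gen i) - gr_one))"
    for ds :: "nat \<Rightarrow> gring"
  \<comment> \<open>The value 0 from \<open>n\<close> on is forced by the description in
    \<open>fox_vec\<close>.\<close>
  define D where "D = (\<lambda>i. if i < n then fox_sum i u else 0)"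
  have gZ: "gr_of (gen i) - gr_one \<in> ZF n" if "i < n" for i
    using that by (auto simp: gr_one_def intro!: ZF_diff ZF_gr_of gen_carrier)
  have "(gr_of u - gr_one) w = (\<Sum>i<n. gr_mult (D i) (gr_of (gen i) - gr_one)) w" for w
  proof (cases "w \<in> C n")
    case True
    then have "(\<Sum>i<n. gr_mult (D i) (gr_of (gen i) - gr_one)) w
        = (\<Sum>i<n. fox_sum i u (fw_mult w [(i, True)]) - fox_sum i u w)"
      unfolding sum_fun_apply using fox_sum_ZF[OF u]
      by (intro sum.cong refl) (simp add: D_def gr_mult_gen[of _ n])
    then show ?thesis using fox_sum_telescope[OF u True] by simp
  next
    case False
    then have "(\<Sum>i<n. gr_mult (D i) (gr_of (gen i) - gr_one)) w = 0"
      using fox_sum_ZF[OF u] gZ by (simp add: sum_fun_apply D_def gr_mult_outside[of _ n])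
    then show ?thesis using False u by (auto simp: gr_of_def gr_one_def)
  qed
  then have "P D"
    using fox_sum_ZF[OF u] by (auto simp: P_def D_def)
  moreover have "ds = D" if "P ds" for ds
  proof -
    have eq: "(\<Sum>i<n. gr_mult (ds i) (gr_of (gen i) - gr_one)) = (\<Sum>i<n. gr_mult (D i) (gr_of (gen i) - gr_one))"
      using \<open>P D\<close> that by (simp add: P_def)
    have "(\<Sum>i<n. (ds i - D i) (fw_mult w [(i, True)]) - (ds i - D i) w) = 0" if w: "w \<in> C n" for w
    proof -
      have "(\<Sum>i<n. ds i (fw_mult w [(i, True)]) - ds i w) = (\<Sum>i<n. D i (fw_mult w [(i, True)]) - D i w)"
      proof -
        have *: "(\<Sum>i<n. gr_mult (f i) (gr_of (gen i) - gr_one)) w = (\<Sum>i<n. f i (fw_mult w [(i, True)]) - f i w)"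
          if "P f" for f
          unfolding sum_fun_apply using that w by (intro sum.cong refl gr_mult_gen[of _ n]) (auto simp: P_def)
        then show ?thesis using *[OF \<open>P D\<close>] *[OF \<open>P ds\<close>] eq by simp
      qed
      then show ?thesis by (simp add: sum_subtractf)
    qed
    then have "ds i - D i = 0" if "i < n" for i
      using fox_unique[of n "\<lambda>i. ds i - D i" i] that \<open>P D\<close> \<open>P ds\<close> by (auto simp: P_def intro: ZF_diff)
    moreover have "ds i = D i" if "\<not> i < n" for i
      using that \<open>P D\<close> \<open>P ds\<close> by (auto simp: P_def)
    ultimately show "ds = D" by (metis eq_iff_diff_eq_0 ext)
  qed
  ultimately have "(THE ds. P ds) = D" by blast
  then show ?thesis using i by (simp add: fox_def fox_vec_def P_def D_def)
qed

section \<open>Augmentation and products of Fox derivatives\<close>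

definition exps :: "nat \<Rightarrow> word \<Rightarrow> int" where
  "exps i w = (\<Sum>l\<leftarrow>w. if fst l = i then (if snd l then - 1 else 1) else 0)"

lemma exps_Cons: "exps i (l # w) = (if fst l = i then (if snd l then - 1 else 1) else 0) + exps i w"
  by (simp add: exps_def)

lemma aug_fox_sum: "u \<in> C n \<Longrightarrow> aug (fox_sum i u) = exps i u"
proof -
  assume u: "u \<in> C n"
  \<comment> \<open>The prefixes of \<open>u\<close> contain the support of every term, so one index
    set serves all terms, even where terms cancel in the sum.\<close>
  define A where "A = (\<lambda>k. take k u) ` {..length u}"
  have "fox_term i u k w = 0" if "w \<notin> A" "k < length u" for k w
    using that by (auto simp: fox_term_def gr_of_def A_def)
  then have "aug (fox_sum i u) = (\<Sum>w\<in>A. fox_sum i u w)"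
    by (intro aug_eq) (auto simp: A_def supp_iff fox_sum_def sum_fun_apply intro!: sum.neutral)
  also have "\<dots> = (\<Sum>k<length u. \<Sum>w\<in>A. fox_term i u k w)"
    unfolding fox_sum_def sum_fun_apply by (rule sum.swap)
  also have "\<dots> = (\<Sum>k<length u. if fst (u ! k) = i then (if snd (u ! k) then - 1 else 1) else 0)"
  proof (intro sum.cong refl)
    fix k assume "k \<in> {..<length u}"
    then have "take k u \<in> A" "take (Suc k) u \<in> A" "finite A" by (auto simp: A_def)
    then show "(\<Sum>w\<in>A. fox_term i u k w) = (if fst (u ! k) = i then (if snd (u ! k) then - 1 else 1) else 0)"
      by (simp add: fox_term_def gr_of_def sum_negf)
  qed
  also have "\<dots> = exps i u"
    by (simp add: exps_def sum_list_sum_nth atLeast0LessThan)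
  finally show ?thesis .
qed

lemma gr_mult_fox_sum:
  assumes u: "u \<in> C n" and b: "b \<in> ZF n" and w: "w \<in> C n"
  shows "gr_mult (fox_sum i u) b w = (\<Sum>k<length u. if fst (u ! k) = i then
      (if snd (u ! k) then - b (fw_mult (winv (take (Suc k) u)) w) else b (fw_mult (winv (take k u)) w)) else 0)"
proof -
  define A where "A = (\<lambda>k. take k u) ` {..length u}"
  have "fox_term i u k w = 0" if "w \<notin> A" "k < length u" for k w
    using that by (auto simp: fox_term_def gr_of_def A_def)
  then have "gr_mult (fox_sum i u) b w = (\<Sum>v\<in>A. fox_sum i u v * b (fw_mult (winv v) w))"
    by (intro gr_mult_left[OF fox_sum_ZF[OF u] b w])
      (auto simp: A_def supp_iff fox_sum_def sum_fun_apply intro!: sum.neutral)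
  also have "\<dots> = (\<Sum>k<length u. \<Sum>v\<in>A. fox_term i u k v * b (fw_mult (winv v) w))"
    unfolding fox_sum_def sum_fun_apply sum_distrib_right by (rule sum.swap)
  also have "\<dots> = (\<Sum>k<length u. if fst (u ! k) = i then
      (if snd (u ! k) then - b (fw_mult (winv (take (Suc k) u)) w) else b (fw_mult (winv (take k u)) w)) else 0)"
  proof (intro sum.cong refl)
    fix k assume "k \<in> {..<length u}"
    then have A: "take k u \<in> A" "take (Suc k) u \<in> A" "finite A" by (auto simp: A_def)
    have *: "(\<Sum>v\<in>A. (if v = g then 1 else 0) * f v) = f g" if "g \<in> A" for g and f :: "word \<Rightarrow> int"
      using that A(3) by (simp add: if_distrib[of "\<lambda>x. x * _"] sum.delta cong: if_cong)
    show "(\<Sum>v\<in>A. fox_term i u k v * b (fw_mult (winv v) w)) = (if fst (u ! k) = i then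
      (if snd (u ! k) then - b (fw_mult (winv (take (Suc k) u)) w) else b (fw_mult (winv (take k u)) w)) else 0)"
      by (simp add: fox_term_def gr_of_def sum_negf *[OF A(1)] *[OF A(2)])
  qed
  finally show ?thesis .
qed

section \<open>Functions on the Cayley tree given by their increments\<close>

context
  fixes r :: "nat \<Rightarrow> gring"
begin

text \<open>A function on the vertices of the Cayley graph is determined, up to a constant,
  by its increments \<open>\<psi> (h x\<^sub>i) - \<psi> h = r\<^sub>i (h\<inverse>)\<close>.\<close>

definition edge_incr :: "word \<Rightarrow> letter \<Rightarrow> int" where
  "edge_incr h l = (if snd l then - r (fst l) (winv (fw_mult h [l])) else r (fst l) (winv h))"

fun path_incr :: "word \<Rightarrow> word \<Rightarrow> int" where
  "path_incr h [] = 0"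
| "path_incr h (l # w) = edge_incr h l + path_incr (fw_mult h [l]) w"

lemma path_incr_append:
  "h \<in> C n \<Longrightarrow> set u \<subseteq> Lt n \<Longrightarrow> path_incr h (u @ v) = path_incr h u + path_incr (fw_mult h u) v"
proof (induction u arbitrary: h)
  case (Cons l u)
  then have "fw_mult h [l] \<in> C n" by (intro mult_carrier) (auto simp: carrier_iff)
  then show ?case using Cons by (simp add: fw_mult_def)
qed simp

lemma path_incr_cancel:
  assumes "h \<in> C n"
  shows "path_incr h (l # linv l # w) = path_incr h w"
proof -
  have "fw_mult (fw_mult h [l]) [linv l] = h"
    using mult_cancel_carrier(3)[OF assms, of "[l]"] by simp
  then show ?thesis by (simp add: edge_incr_def)
qed

text \<open>Going along an edge and back contributes 0, so the increment depends only on the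
  endpoints. The Cayley graph is a tree, hence arbitrary increments on its edges integrate to a
  function.\<close>

lemma path_incr_red:
  "h \<in> C n \<Longrightarrow> set w \<subseteq> Lt n \<Longrightarrow> path_incr h (red w) = path_incr h w"
proof (induction w arbitrary: h)
  case (Cons l w)
  have "fw_mult h [l] \<in> C n" using Cons.prems by (intro mult_carrier) (auto simp: carrier_iff)
  then have *: "path_incr h (l # red w) = path_incr h (l # w)"
    using Cons by simp
  show ?case
  proof (cases "\<exists>w'. red w = linv l # w'")
    case True
    then obtain w' where w': "red w = linv l # w'" by blast
    have "red (l # w) = w'" by (simp add: red_Cons w')
    then show ?thesis using * path_incr_cancel[OF Cons.prems(1), of l w'] w' by simp
  next
    case False
    then have "red (l # w) = l # red w"
      by (auto simp: red_Cons split: list.split)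
    then show ?thesis using * by simp
  qed
qed simp

lemma path_incr_mult:
  assumes "h \<in> C n" "g \<in> C n"
  shows "path_incr [] (fw_mult h g) = path_incr [] h + path_incr h g"
proof -
  have "path_incr [] (fw_mult h g) = path_incr [] (h @ g)"
    unfolding fw_mult_def using assms by (intro path_incr_red[of _ n]) (auto simp: carrier_iff)
  moreover have "fw_mult [] h = h" using assms(1) by simp
  ultimately show ?thesis using assms path_incr_append[of "[]" n h g] by (simp add: carrier_iff)
qed

lemma path_incr_sum:
  "h \<in> C n \<Longrightarrow> set u \<subseteq> Lt n \<Longrightarrow>
    path_incr h u = (\<Sum>k<length u. edge_incr (fw_mult h (take k u)) (u ! k))"
proof (induction u rule: rev_induct)
  case (snoc l u)
  then have "path_incr h (u @ [l]) = path_incr h u + edge_incr (fw_mult h u) l"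
    by (simp add: path_incr_append)
  also have "\<dots> = (\<Sum>k<length (u @ [l]). edge_incr (fw_mult h (take k (u @ [l]))) ((u @ [l]) ! k))"
    using snoc by (simp add: nth_append)
  finally show ?case .
qed simp

lemma finite_edge_incr:
  assumes r: "\<And>i. i < n \<Longrightarrow> r i \<in> ZF n" and l: "fst l < n"
  shows "finite {h \<in> C n. edge_incr h l \<noteq> 0}"
proof -
  let ?S = "winv ` supp (r (fst l))"
  have fin: "finite ?S" using r l by (simp add: ZF_iff)
  show ?thesis
  proof (cases "snd l")
    case False
    have "{h \<in> C n. edge_incr h l \<noteq> 0} \<subseteq> ?S"
    proof
      fix h assume "h \<in> {h \<in> C n. edge_incr h l \<noteq> 0}"
      then show "h \<in> ?S"
        using False by (intro image_eqI[of _ _ "winv h"]) (auto simp: edge_incr_def supp_iff)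
    qed
    then show ?thesis using fin finite_subset by blast
  next
    case True
    have "h \<in> (\<lambda>g. fw_mult g [linv l]) ` ?S" if "h \<in> C n" "edge_incr h l \<noteq> 0" for h
    proof -
      have "h = fw_mult (fw_mult h [l]) [linv l]"
        using mult_cancel_carrier(3)[OF that(1), of "[l]"] by simp
      moreover have "fw_mult h [l] \<in> ?S"
        using that True by (intro image_eqI[of _ _ "winv (fw_mult h [l])"]) (auto simp: edge_incr_def supp_iff)
      ultimately show ?thesis by blast
    qed
    then have "{h \<in> C n. edge_incr h l \<noteq> 0} \<subseteq> (\<lambda>g. fw_mult g [linv l]) ` ?S" by blast
    then show ?thesis using fin finite_subset by blast
  qed
qed

text \<open>The path \<open>g\<close> read from \<open>h\<close> must traverse one of the finitely
  many edges with nonzero increment. This is the local constancy near the ends.\<close>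

lemma finite_path_incr:
  assumes r: "\<And>i. i < n \<Longrightarrow> r i \<in> ZF n" and "set g \<subseteq> Lt n"
  shows "finite {h \<in> C n. path_incr h g \<noteq> 0}"
  using assms(2)
proof (induction g)
  case (Cons l g)
  let ?S = "{h \<in> C n. path_incr h g \<noteq> 0}"
  have l: "fst l < n" "[l] \<in> C n" using Cons by (auto simp: carrier_iff)
  have "h \<in> {h \<in> C n. edge_incr h l \<noteq> 0} \<union> (\<lambda>h. fw_mult h [linv l]) ` ?S"
    if h: "h \<in> C n" "path_incr h (l # g) \<noteq> 0" for h
  proof (cases "edge_incr h l = 0")
    case True
    have "h = fw_mult (fw_mult h [l]) [linv l]"
      using mult_cancel_carrier(3)[OF h(1), of "[l]"] by simp
    moreover have "fw_mult h [l] \<in> ?S" using True h l by simp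
    ultimately show ?thesis by blast
  qed (use h in simp)
  then have "{h \<in> C n. path_incr h (l # g) \<noteq> 0} \<subseteq>
      {h \<in> C n. edge_incr h l \<noteq> 0} \<union> (\<lambda>h. fw_mult h [linv l]) ` ?S" by blast
  moreover have "finite ({h \<in> C n. edge_incr h l \<noteq> 0} \<union> (\<lambda>h. fw_mult h [linv l]) ` ?S)"
    using finite_edge_incr[OF r l(1)] Cons by simp
  ultimately show ?case using finite_subset by blast
qed simp

text \<open>The bridge from algebra to the tree: a prefix \<open>v\<close> of \<open>u\<close>,
  multiplied with \<open>r i\<close>, has at \<open>winv h\<close> the coefficient of
  \<open>r i\<close> at the inverse of \<open>h v\<close>, and this is, up to sign, the increment of
  the edge that \<open>u\<close> read from \<open>h\<close> traverses there.\<close>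

lemma path_incr_fox:
  assumes r: "\<And>i. i < n \<Longrightarrow> r i \<in> ZF n" and u: "u \<in> C n" and h: "h \<in> C n"
  shows "path_incr h u = (\<Sum>i<n. gr_mult (fox_sum i u) (r i)) (winv h)"
proof -
  let ?f = "\<lambda>i k. if snd (u ! k) then - r i (fw_mult (winv (take (Suc k) u)) (winv h))
      else r i (fw_mult (winv (take k u)) (winv h))"
  have "(\<Sum>i<n. gr_mult (fox_sum i u) (r i)) (winv h) = (\<Sum>i<n. \<Sum>k<length u. if fst (u ! k) = i then ?f i k else 0)"
    unfolding sum_fun_apply using r u h by (intro sum.cong refl gr_mult_fox_sum) auto
  also have "\<dots> = (\<Sum>k<length u. \<Sum>i<n. if fst (u ! k) = i then ?f i k else 0)"
    by (rule sum.swap)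
  also have "\<dots> = (\<Sum>k<length u. edge_incr (fw_mult h (take k u)) (u ! k))"
  proof (intro sum.cong refl)
    fix k assume k: "k \<in> {..<length u}"
    then have "fst (u ! k) < n" using u nth_mem[of k u] by (auto simp: carrier_iff simp del: nth_mem)
    then have "(\<Sum>i<n. if fst (u ! k) = i then ?f i k else 0) = ?f (fst (u ! k)) k"
      by (simp add: sum.delta')
    moreover have "fw_mult (fw_mult h (take k u)) [u ! k] = fw_mult h (take (Suc k) u)"
      using k by (simp add: fw_mult_def take_Suc_conv_app_nth)
    ultimately show "(\<Sum>i<n. if fst (u ! k) = i then ?f i k else 0) = edge_incr (fw_mult h (take k u)) (u ! k)"
      by (simp add: edge_incr_def winv_mult)
  qed
  finally show ?thesis using path_incr_sum[OF h, of u] u by (simp add: carrier_iff)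
qed

end

section \<open>An invariant form of \<Delta>-primitivity\<close>

definition homZ :: "nat \<Rightarrow> (word \<Rightarrow> int) \<Rightarrow> bool" where
  "homZ n \<theta> \<longleftrightarrow> (\<forall>x\<in>C n. \<forall>y\<in>C n. \<theta> (fw_mult x y) = \<theta> x + \<theta> y)"

lemma homZ_exps:
  assumes "homZ n \<theta>" "w \<in> C n"
  shows "\<theta> w = (\<Sum>i<n. \<theta> (gen i) * exps i w)"
proof -
  have Nil: "\<theta> [] = 0" using assms(1) by (force simp: homZ_def fw_mult_def dest: bspec[of _ _ "[]"])
  have inv: "\<theta> [(i, True)] = - \<theta> [(i, False)]" if "i < n" for i
  proof -
    have c: "[(i, True)] \<in> C n" "[(i, False)] \<in> C n" using that by (auto simp: carrier_iff)
    have "fw_mult [(i, True)] [(i, False)] = []" using mult_cancel(10)[of "[(i, False)]"] by simp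
    moreover have "\<theta> (fw_mult [(i, True)] [(i, False)]) = \<theta> [(i, True)] + \<theta> [(i, False)]"
      using assms(1) c unfolding homZ_def by blast
    ultimately show ?thesis using Nil by simp
  qed
  have "set w \<subseteq> Lt n \<Longrightarrow> \<theta> (red w) = (\<Sum>i<n. \<theta> (gen i) * exps i w)"
  proof (induction w)
    case Nil
    then show ?case using \<open>\<theta> [] = 0\<close> by (simp add: exps_def)
  next
    case (Cons l w)
    obtain j b where l: "l = (j, b)" by (cases l)
    have j: "j < n" "[l] \<in> C n" using Cons by (auto simp: carrier_iff l)
    have "red w \<in> C n" using Cons by (intro red_carrier) auto
    then have "\<theta> (red (l # w)) = \<theta> [l] + \<theta> (red w)"
      using assms(1) j unfolding homZ_def red_to_mult_Cons by blast
    also have "\<theta> [l] = (\<Sum>i<n. if i = j then \<theta> (gen i) * (if b then - 1 else 1) else 0)"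
      using j inv by (auto simp: l gen_def)
    also have "\<dots> + \<theta> (red w) = (\<Sum>i<n. \<theta> (gen i) * exps i (l # w))"
    proof -
      have "\<theta> (red w) = (\<Sum>i<n. \<theta> (gen i) * exps i w)" using Cons by simp
      then show ?thesis
        by (simp only: sum.distrib[symmetric]) (intro sum.cong, auto simp: exps_Cons l algebra_simps)
    qed
    finally show ?case .
  qed
  then show ?thesis using assms(2) by (simp add: carrier_iff)
qed

text \<open>This reformulates \<open>\<Delta>\<close>-primitivity in terms that only involve the group,
  so that invariance under automorphisms is clear: every \<open>h\<^sub>1 - h\<^sub>2\<close> is
  \<open>(u - 1) \<psi>\<close> for an almost invariant function \<open>\<psi>\<close> on the group.\<close>

definition separating :: "nat \<Rightarrow> word \<Rightarrow> bool" where
  "separating n u \<longleftrightarrow> u \<in> C n \<and> (\<forall>\<theta>. homZ n \<theta> \<longrightarrow> \<theta> u = 0) \<and>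
     (\<forall>h1\<in>C n. \<forall>h2\<in>C n. \<exists>\<psi> :: word \<Rightarrow> int.
        (\<forall>g\<in>C n. finite {h \<in> C n. \<psi> (fw_mult h g) \<noteq> \<psi> h}) \<and>
        (\<forall>h\<in>C n. \<psi> (fw_mult h u) - \<psi> h = of_bool (h = h1) - of_bool (h = h2)))"

lemma separatingE:
  assumes "separating n u" "h1 \<in> C n" "h2 \<in> C n"
  obtains \<psi> :: "word \<Rightarrow> int"
  where "\<And>g. g \<in> C n \<Longrightarrow> finite {h \<in> C n. \<psi> (fw_mult h g) \<noteq> \<psi> h}"
    and "\<And>h. h \<in> C n \<Longrightarrow> \<psi> (fw_mult h u) - \<psi> h = of_bool (h = h1) - of_bool (h = h2)"
  using assms unfolding separating_def by blast

lemma Delta_primitive_separating: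
  assumes "Delta_primitive n u"
  shows "separating n u"
proof -
  have u: "u \<in> C n" and D: "Delta n = {\<Sum>i<n. gr_mult (fox_sum i u) (r i) | r. \<forall>i<n. r i \<in> ZF n}"
    using assms by (auto simp: Delta_primitive_def fox_eq)
  have exps: "exps i u = 0" if i: "i < n" for i
  proof -
    \<comment> \<open>This choice exhibits the derivative itself as a member of the right ideal,
      hence of \<Delta>; its augmentation is the exponent sum.\<close>
    define r where "r = (\<lambda>j. if j = i then gr_one else (0 :: gring))"
    have r: "r j \<in> ZF n" for j by (auto simp: r_def gr_one_def intro: ZF_gr_of)
    have "(\<Sum>j<n. gr_mult (fox_sum j u) (r j)) = (\<Sum>j<n. if j = i then gr_mult (fox_sum i u) gr_one else 0)"
      by (intro sum.cong refl) (auto simp: r_def gr_mult_def supp_def fun_eq_iff)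
    also have "\<dots> = gr_mult (fox_sum i u) gr_one" using i by simp
    also have "\<dots> = fox_sum i u"
    proof
      fix w
      have 1: "gr_one \<in> ZF n" by (auto simp: gr_one_def intro: ZF_gr_of)
      show "gr_mult (fox_sum i u) gr_one w = fox_sum i u w"
      proof (cases "w \<in> C n")
        case True
        show ?thesis
          using gr_mult_right[OF fox_sum_ZF[OF u, of i] 1 True, of "{[]}"] True
          by (simp add: supp_def gr_one_def gr_of_def)
      next
        case False
        then show ?thesis
          using gr_mult_outside[OF fox_sum_ZF[OF u] 1] ZF_outside[OF fox_sum_ZF[OF u]] by simp
      qed
    qed
    finally have "fox_sum i u = (\<Sum>j<n. gr_mult (fox_sum j u) (r j))" ..
    then have "fox_sum i u \<in> Delta n" unfolding D using r by blast
    then show ?thesis using aug_fox_sum[OF u] by (simp add: Delta_def)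
  qed
  have "\<exists>\<psi> :: word \<Rightarrow> int. (\<forall>g\<in>C n. finite {h \<in> C n. \<psi> (fw_mult h g) \<noteq> \<psi> h}) \<and>
        (\<forall>h\<in>C n. \<psi> (fw_mult h u) - \<psi> h = of_bool (h = h1) - of_bool (h = h2))"
    if h: "h1 \<in> C n" "h2 \<in> C n" for h1 h2
  proof -
    \<comment> \<open>The inverses compensate for \<open>path_incr_fox\<close>, which evaluates at
      \<open>winv h\<close>.\<close>
    define d where "d = gr_of (winv h1) - gr_of (winv h2)"
    have "d \<in> ZF n" using h by (simp add: d_def ZF_diff ZF_gr_of)
    moreover have "aug d = 0"
    proof -
      have "aug d = (\<Sum>w\<in>{winv h1, winv h2}. d w)"
        by (rule aug_eq) (auto simp: d_def gr_of_def supp_def)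
      also have "\<dots> = 0" by (cases "winv h1 = winv h2") (auto simp: d_def gr_of_def)
      finally show ?thesis .
    qed
    ultimately have "d \<in> Delta n" by (simp add: Delta_def)
    then obtain r where r: "\<And>i. i < n \<Longrightarrow> r i \<in> ZF n" and d: "d = (\<Sum>i<n. gr_mult (fox_sum i u) (r i))"
      unfolding D by blast
    have winv_eq: "winv h = winv k \<longleftrightarrow> h = k" for h k by (metis winv_simps(4))
    have "finite {h \<in> C n. path_incr r [] (fw_mult h g) \<noteq> path_incr r [] h}" if "g \<in> C n" for g
    proof -
      have "{h \<in> C n. path_incr r [] (fw_mult h g) \<noteq> path_incr r [] h} = {h \<in> C n. path_incr r h g \<noteq> 0}"
        using that by (auto simp: path_incr_mult[of _ n])
      then show ?thesis using finite_path_incr[of n r g] r that by (simp add: carrier_iff)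
    qed
    moreover have "path_incr r [] (fw_mult h u) - path_incr r [] h = of_bool (h = h1) - of_bool (h = h2)"
      if "h \<in> C n" for h
    proof -
      have "path_incr r [] (fw_mult h u) - path_incr r [] h = path_incr r h u"
        using path_incr_mult[OF that u] by simp
      also have "\<dots> = d (winv h)" using path_incr_fox[OF r u that] d by simp
      also have "\<dots> = of_bool (h = h1) - of_bool (h = h2)" by (simp add: d_def gr_of_def winv_eq)
      finally show ?thesis .
    qed
    ultimately show ?thesis by blast
  qed
  moreover have "\<theta> u = 0" if "homZ n \<theta>" for \<theta>
    using homZ_exps[OF that u] exps by simp
  ultimately show ?thesis using u by (auto simp: separating_def)
qed

lemma iso_mult: "\<phi> \<in> iso (free_grp n) (free_grp n) \<Longrightarrow> x \<in> C n \<Longrightarrow> y \<in> C n \<Longrightarrow>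
    \<phi> (fw_mult x y) = fw_mult (\<phi> x) (\<phi> y)"
  by (auto simp: iso_def hom_def)

lemma iso_carrier: "\<phi> \<in> iso (free_grp n) (free_grp n) \<Longrightarrow> x \<in> C n \<Longrightarrow> \<phi> x \<in> C n"
  by (auto simp: iso_def hom_def)

text \<open>Compose \<psi> with the inverse automorphism. Finiteness in \<open>separating\<close> is
  demanded for every \<open>g\<close>, not only for generators, so it transfers without reference to
  a basis.\<close>

lemma separating_iso:
  assumes sep: "separating n u" and \<phi>: "\<phi> \<in> iso (free_grp n) (free_grp n)"
  shows "separating n (\<phi> u)"
proof -
  define \<chi> where "\<chi> = inv_into (C n) \<phi>"
  have bij: "bij_betw \<phi> (C n) (C n)" using \<phi> by (auto simp: iso_def)
  have \<chi>: "\<chi> \<in> iso (free_grp n) (free_grp n)"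
    unfolding \<chi>_def using \<phi> group_free_grp by (intro group.iso_set_sym) auto
  have \<chi>\<phi>: "\<chi> (\<phi> x) = x" "\<phi> (\<chi> x) = x" if "x \<in> C n" for x
    using that bij by (auto simp: \<chi>_def bij_betw_def f_inv_into_f)
  note c = iso_carrier[OF \<phi>] iso_carrier[OF \<chi>]
  have u: "u \<in> C n" using sep by (simp add: separating_def)
  have "\<theta> (\<phi> u) = 0" if "homZ n \<theta>" for \<theta>
  proof -
    have "homZ n (\<lambda>x. \<theta> (\<phi> x))"
      using that by (auto simp: homZ_def iso_mult[OF \<phi>] c)
    then show ?thesis using sep by (auto simp: separating_def)
  qed
  moreover have "\<exists>\<psi> :: word \<Rightarrow> int. (\<forall>g\<in>C n. finite {h \<in> C n. \<psi> (fw_mult h g) \<noteq> \<psi> h}) \<and>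
        (\<forall>h\<in>C n. \<psi> (fw_mult h (\<phi> u)) - \<psi> h = of_bool (h = h1) - of_bool (h = h2))"
    if h: "h1 \<in> C n" "h2 \<in> C n" for h1 h2
  proof -
    obtain \<psi> :: "word \<Rightarrow> int" where fin: "\<And>g. g \<in> C n \<Longrightarrow> finite {h \<in> C n. \<psi> (fw_mult h g) \<noteq> \<psi> h}"
      and eq: "\<And>h. h \<in> C n \<Longrightarrow> \<psi> (fw_mult h u) - \<psi> h = of_bool (h = \<chi> h1) - of_bool (h = \<chi> h2)"
      using separatingE[OF sep c(2)[OF h(1)] c(2)[OF h(2)]] by blast
    have "finite {h \<in> C n. \<psi> (\<chi> (fw_mult h g)) \<noteq> \<psi> (\<chi> h)}" if g: "g \<in> C n" for g
    proof -
      have "{h \<in> C n. \<psi> (\<chi> (fw_mult h g)) \<noteq> \<psi> (\<chi> h)} \<subseteq> \<phi> ` {h \<in> C n. \<psi> (fw_mult h (\<chi> g)) \<noteq> \<psi> h}"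
      proof
        fix h assume "h \<in> {h \<in> C n. \<psi> (\<chi> (fw_mult h g)) \<noteq> \<psi> (\<chi> h)}"
        then show "h \<in> \<phi> ` {h \<in> C n. \<psi> (fw_mult h (\<chi> g)) \<noteq> \<psi> h}"
          using g c \<chi>\<phi> by (intro image_eqI[of _ _ "\<chi> h"]) (auto simp: iso_mult[OF \<chi>])
      qed
      then show ?thesis using fin[OF c(2)[OF g]] finite_subset by blast
    qed
    moreover have "\<psi> (\<chi> (fw_mult h (\<phi> u))) - \<psi> (\<chi> h) = of_bool (h = h1) - of_bool (h = h2)"
      if k: "h \<in> C n" for h
    proof -
      have "\<chi> h = \<chi> k \<longleftrightarrow> h = k" if "k \<in> C n" for k
        using \<chi>\<phi>(2)[OF k] \<chi>\<phi>(2)[OF that] by metis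
      then show ?thesis using eq[OF c(2)[OF k]] k u c h \<chi>\<phi> by (simp add: iso_mult[OF \<chi>])
    qed
    ultimately show ?thesis by (intro exI[of _ "\<lambda>h. \<psi> (\<chi> h)"]) blast
  qed
  ultimately show ?thesis using u c by (auto simp: separating_def)
qed

lemma exps_append: "exps i (u @ v) = exps i u + exps i v"
  by (simp add: exps_def)

lemma exps_red: "exps i (red w) = exps i w"
proof (induction w)
  case (Cons a w)
  have "exps i (a # red w) = exps i (a # w)" using Cons by (simp add: exps_def)
  moreover have "exps i (red (a # w)) = exps i (a # red w)"
    by (cases a) (auto simp: red_Cons exps_def split: list.split)
  ultimately show ?case by simp
qed simp

lemma homZ_exps_i: "homZ n (exps i)"
  by (simp add: homZ_def fw_mult_def exps_red exps_append)

lemma separating_exps: "separating n u \<Longrightarrow> exps i u = 0"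
  using homZ_exps_i by (auto simp: separating_def)

text \<open>If \<open>x\<^sub>i\<close> were missing from \<open>u\<close>, summing the increments of \<open>\<psi>\<close> over the kernel of \<open>exps i\<close>
  would give a homomorphism that has to vanish at \<open>u\<close>; but \<open>1\<close> and \<open>x\<^sub>i\<close> lie in different cosets.\<close>

lemma separating_full_support:
  assumes sep: "separating n u" and i: "i < n"
  shows "i \<in> fst ` set u"
proof (rule ccontr)
  assume missing: "i \<notin> fst ` set u"
  have u: "u \<in> C n" using sep by (simp add: separating_def)
  obtain \<psi> :: "word \<Rightarrow> int" where fin: "\<And>g. g \<in> C n \<Longrightarrow> finite {h \<in> C n. \<psi> (fw_mult h g) \<noteq> \<psi> h}"
      and eq: "\<And>h. h \<in> C n \<Longrightarrow> \<psi> (fw_mult h u) - \<psi> h = of_bool (h = []) - of_bool (h = gen i)"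
    using separatingE[OF sep Nil_carrier gen_carrier[OF i]] by blast
  define K where "K = {h \<in> C n. exps i h = 0}"
  define A where "A g = {h \<in> C n. \<psi> (fw_mult h g) \<noteq> \<psi> h}" for g
  define S where "S g = (\<Sum>h\<in>K \<inter> A g. \<psi> (fw_mult h g) - \<psi> h)" for g
  have S_eq: "S g = (\<Sum>h\<in>B. \<psi> (fw_mult h g) - \<psi> h)" if "finite B" "B \<subseteq> K" "K \<inter> A g \<subseteq> B" for g B
    unfolding S_def by (rule sum.mono_neutral_left) (use that in \<open>auto simp: A_def K_def\<close>)
  have K_mult: "fw_mult h g \<in> K" if "h \<in> K" "g \<in> K" for g h
    using that by (auto simp: K_def) (simp add: fw_mult_def exps_red exps_append)
  have S_mult: "S (fw_mult g g') = S g + S g'" if g: "g \<in> K" "g' \<in> C n" for g g'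
  proof -
    have gC: "g \<in> C n" using g by (simp add: K_def)
    have winvg: "winv g \<in> K"
    proof -
      have "exps i (fw_mult g (winv g)) = 0" by (simp add: mult_cancel) (simp add: exps_def)
      moreover have "exps i (fw_mult g (winv g)) = exps i g + exps i (winv g)"
        by (simp only: fw_mult_def exps_red exps_append)
      ultimately show ?thesis using g by (simp add: K_def)
    qed
    \<comment> \<open>Right multiplication by \<open>g\<close> permutes \<open>K\<close> because
      \<open>g \<in> K\<close>. \<open>B\<close> is a finite part of \<open>K\<close> large enough
      for all the sums, so that one of them can be reindexed by \<open>h g\<close>.\<close>
    define B where "B = K \<inter> (A g \<union> (\<lambda>h. fw_mult h (winv g)) ` A g' \<union> A (fw_mult g g'))"
    have B: "finite B" "B \<subseteq> K"
      using fin g gC mult_carrier[OF gC g(2)] by (auto simp: B_def A_def)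
    have inj: "inj_on (\<lambda>h. fw_mult h g) B"
      using B(2) mult_cancel_carrier(3)[of _ n g] by (intro inj_on_inverseI[where g = "\<lambda>h. fw_mult h (winv g)"]) (auto simp: K_def)
    have "S (fw_mult g g') = (\<Sum>h\<in>B. \<psi> (fw_mult (fw_mult h g) g') - \<psi> h)"
      using B by (subst S_eq[of B]) (auto simp: B_def mult_assoc)
    also have "\<dots> = (\<Sum>h\<in>B. \<psi> (fw_mult (fw_mult h g) g') - \<psi> (fw_mult h g)) + (\<Sum>h\<in>B. \<psi> (fw_mult h g) - \<psi> h)"
      by (simp add: sum.distrib[symmetric])
    also have "(\<Sum>h\<in>B. \<psi> (fw_mult h g) - \<psi> h) = S g"
      using B by (subst S_eq[of B]) (auto simp: B_def)
    also have "(\<Sum>h\<in>B. \<psi> (fw_mult (fw_mult h g) g') - \<psi> (fw_mult h g))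
        = (\<Sum>h\<in>(\<lambda>h. fw_mult h g) ` B. \<psi> (fw_mult h g') - \<psi> h)"
      by (simp add: sum.reindex[OF inj])
    also have "\<dots> = S g'"
    proof (rule S_eq[symmetric])
      show "finite ((\<lambda>h. fw_mult h g) ` B)" using B by simp
      show "(\<lambda>h. fw_mult h g) ` B \<subseteq> K" using B K_mult g by auto
      show "K \<inter> A g' \<subseteq> (\<lambda>h. fw_mult h g) ` B"
      proof
        fix h assume h: "h \<in> K \<inter> A g'"
        then have "h = fw_mult (fw_mult h (winv g)) g"
          using mult_cancel_carrier(4)[of h n g] by (simp add: K_def)
        moreover have "fw_mult h (winv g) \<in> B" using h K_mult winvg by (auto simp: B_def)
        ultimately show "h \<in> (\<lambda>h. fw_mult h g) ` B" by blast
      qed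
    qed
    finally show ?thesis by simp
  qed
  \<comment> \<open>Additivity of \<open>S\<close> is available only for left factors in
    \<open>K\<close>. Its values at the generators other than \<open>x_i\<close> still define a
    homomorphism on all of \<open>F\<close>, which agrees with \<open>S\<close> on words without
    \<open>x_i\<close>.\<close>
  define \<theta> where "\<theta> w = (\<Sum>j<n. (if j = i then 0 else S (gen j)) * exps j w)" for w
  have "homZ n \<theta>"
    using homZ_exps_i by (auto simp: homZ_def \<theta>_def sum.distrib[symmetric] algebra_simps)
  then have "\<theta> u = 0" using sep by (simp add: separating_def)
  moreover have "S (red w) = \<theta> w" if "set w \<subseteq> Lt n" "i \<notin> fst ` set w" for w
    using that
  proof (induction w)
    case Nil
    then show ?case using S_mult[of "[]" "[]"] by (simp add: K_def exps_def \<theta>_def fw_mult_def)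
  next
    case (Cons l w)
    obtain j b where l: "l = (j, b)" by (cases l)
    have j: "j < n" "j \<noteq> i" using Cons.prems by (auto simp: l)
    have jK: "[(j, b)] \<in> K" for b using j by (auto simp: K_def carrier_iff exps_def)
    have S0: "S [] = 0" using S_mult[of "[]" "[]"] by (simp add: K_def exps_def fw_mult_def)
    have "S [(j, True)] = - S (gen j)"
      using S_mult[OF jK, of "gen j" True] mult_cancel(10)[of "gen j"] gen_carrier[OF j(1)] S0
      by (simp add: gen_def)
    then have "S [l] = (if b then - S (gen j) else S (gen j))" by (simp add: l gen_def)
    also have "\<dots> = (\<Sum>k<n. if k = j then (if k = i then 0 else S (gen k)) * (if b then - 1 else 1) else 0)"
      using j by simp
    finally have Sl: "S [l] = \<dots>" .
    have "red w \<in> C n" using Cons.prems by (intro red_carrier) auto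
    then have "S (red (l # w)) = S [l] + S (red w)"
      unfolding red_to_mult_Cons using S_mult[OF jK[of b]] l by simp
    also have "\<dots> = \<theta> (l # w)"
    proof -
      have "S (red w) = \<theta> w" using Cons by simp
      then show ?thesis
        by (simp only: Sl \<theta>_def sum.distrib[symmetric]) (intro sum.cong, auto simp: exps_Cons l algebra_simps)
    qed
    finally show ?case .
  qed
  then have "S u = \<theta> u" using u missing red_reduced[of u] by (metis carrier_iff)
  ultimately have "S u = 0" by simp
  moreover have "S u = (\<Sum>h\<in>{[]}. \<psi> (fw_mult h u) - \<psi> h)"
  proof (rule S_eq)
    have "gen i \<notin> K" by (simp add: K_def exps_def gen_def)
    show "K \<inter> A u \<subseteq> {[]}"
    proof
      fix h assume h: "h \<in> K \<inter> A u"
      then have "h \<noteq> gen i" using \<open>gen i \<notin> K\<close> by auto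
      then show "h \<in> {[]}" using h eq[of h] by (cases "h = []") (auto simp: A_def K_def)
    qed
  qed (auto simp: K_def exps_def)
  moreover have "\<dots> = 1" using eq[OF Nil_carrier] by (simp add: gen_def)
  ultimately show False by simp
qed

section \<open>Cyclic words and Whitehead automorphisms\<close>

text \<open>A pair of cyclically consecutive letters. It is encoded by a splitting of
  \<open>u\<close>, since the same \<open>P\<close> and \<open>Q\<close> later give the translate of
  the axis that takes this turn at a given vertex. An empty \<open>Q\<close> is the turn from the
  last letter to the first.\<close>

definition turn :: "word \<Rightarrow> letter \<Rightarrow> letter \<Rightarrow> bool" where
  "turn u a b \<longleftrightarrow> (\<exists>P Q. u = P @ Q \<and> P \<noteq> [] \<and> a = last P \<and> b = hd (Q @ P))"

lemma turn_set: "turn u a b \<Longrightarrow> a \<in> set u \<and> b \<in> set u"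
  by (auto simp: turn_def hd_append)

lemma turn_next: "l \<in> set u \<Longrightarrow> \<exists>b. turn u l b"
proof -
  assume "l \<in> set u"
  then obtain X Y where "u = (X @ [l]) @ Y" by (auto dest: split_list)
  then show ?thesis unfolding turn_def by (metis last_snoc snoc_eq_iff_butlast)
qed

lemma turn_prev: "l \<in> set u \<Longrightarrow> \<exists>a. turn u a l"
proof -
  assume "l \<in> set u"
  then obtain X Y where u: "u = X @ l # Y" by (auto dest: split_list)
  show ?thesis
  proof (cases X rule: rev_cases)
    case Nil
    then have "turn u (last u) l" unfolding turn_def using u by (intro exI[of _ u] exI[of _ "[]"]) auto
    then show ?thesis ..
  next
    case (snoc X' a)
    then have "turn u a l" unfolding turn_def using u by (intro exI[of _ "X' @ [a]"] exI[of _ "l # Y"]) auto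
    then show ?thesis ..
  qed
qed

definition cyc_reduced :: "word \<Rightarrow> bool" where
  "cyc_reduced u \<longleftrightarrow> reduced (u @ u)"

lemma turn_reduced:
  assumes "cyc_reduced u" "turn u a b"
  shows "b \<noteq> linv a"
proof -
  obtain P Q where PQ: "u = P @ Q" "P \<noteq> []" "a = last P" "b = hd (Q @ P)"
    using assms(2) by (auto simp: turn_def)
  have "reduced (P @ Q @ P @ Q)" using assms(1) PQ by (simp add: cyc_reduced_def)
  then have "reduced (P @ Q @ P)" using reduced_append[of "P @ Q @ P" Q] by simp
  then show ?thesis using reduced_append[of P "Q @ P"] PQ by simp
qed

lemma successively_split:
  "(\<And>X a b Y. xs = X @ a # b # Y \<Longrightarrow> R a b) \<Longrightarrow> successively R xs"
proof (induction xs rule: induct_list012)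
  case (3 x y zs)
  have "R x y" using "3.prems"[of "[]" x y zs] by simp
  moreover have "R a b" if "y # zs = X @ a # b # Y" for X a b Y
    using "3.prems"[of "x # X" a b Y] that by simp
  ultimately show ?case using "3.IH"(2) by simp
qed auto

text \<open>Padding with the cyclic neighbours reduces statements on the cyclic word to linear
  inductions.\<close>

lemma successively_turns:
  assumes "u \<noteq> []" "\<And>a b. turn u a b \<Longrightarrow> R a b"
  shows "successively R (last u # u @ [hd u])"
proof (rule successively_split)
  fix X a b Y assume eq: "last u # u @ [hd u] = X @ a # b # Y"
  have "turn u a b"
  proof (cases X)
    case Nil
    then have "a = last u" "b = hd u" using eq assms(1) by (auto simp: hd_append dest: arg_cong[of _ _ hd])
    then show ?thesis unfolding turn_def using assms(1) by (intro exI[of _ u] exI[of _ "[]"]) auto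
  next
    case (Cons x X')
    then have eq: "u @ [hd u] = X' @ a # b # Y" using eq by simp
    show ?thesis
    proof (cases Y rule: rev_cases)
      case Nil
      then have "u = X' @ [a]" "b = hd u" using eq append_eq_append_conv[of "[hd u]" "[b]" u "X' @ [a]"] by auto
      then show ?thesis unfolding turn_def using assms(1) by (intro exI[of _ u] exI[of _ "[]"]) auto
    next
      case (snoc Y' y)
      then have "u = X' @ a # b # Y'" using eq append_eq_append_conv[of "[hd u]" "[y]" u "X' @ a # b # Y'"] by auto
      then show ?thesis unfolding turn_def by (intro exI[of _ "X' @ [a]"] exI[of _ "b # Y'"]) auto
    qed
  qed
  then show "R a b" by (rule assms(2))
qed

lemma successively_const:
  "successively (\<lambda>a b. f a = f b) (a # w) \<Longrightarrow> l \<in> set w \<Longrightarrow> f l = f a"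
proof (induction w arbitrary: a)
  case (Cons b w)
  then have "f a = f b" "successively (\<lambda>a b. f a = f b) (b # w)" by simp_all
  then show ?case using Cons.IH[of b] Cons.prems(2) by (metis set_ConsD)
qed simp

lemma letter_or_inverse: "fst s \<in> fst ` set u \<Longrightarrow> s \<in> set u \<or> linv s \<in> set u"
  using fst_eq_iff[of s] by (metis imageE)

lemma conj_iso:
  assumes Z: "Z \<in> C n"
  shows "(\<lambda>x. fw_mult (winv Z) (fw_mult x Z)) \<in> iso (free_grp n) (free_grp n)"
proof -
  have "bij_betw (\<lambda>x. fw_mult (winv Z) (fw_mult x Z)) (C n) (C n)"
  proof (rule bij_betw_byWitness[where f' = "\<lambda>x. fw_mult Z (fw_mult x (winv Z))"])
    show "\<forall>a\<in>C n. fw_mult Z (fw_mult (fw_mult (winv Z) (fw_mult a Z)) (winv Z)) = a"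
      using Z mult_cancel_carrier by (metis mult_assoc)
    show "\<forall>a\<in>C n. fw_mult (winv Z) (fw_mult (fw_mult Z (fw_mult a (winv Z))) Z) = a"
      using Z mult_cancel_carrier by (metis mult_assoc)
  qed (use Z in auto)
  moreover have "fw_mult (winv Z) (fw_mult (fw_mult x y) Z)
      = fw_mult (fw_mult (winv Z) (fw_mult x Z)) (fw_mult (winv Z) (fw_mult y Z))"
    if "x \<in> C n" "y \<in> C n" for x y
    using that Z by (simp add: mult_assoc mult_cancel_carrier[where n = n])
  ultimately show ?thesis using Z by (auto simp: iso_def hom_def)
qed

section \<open>The action of a Whitehead automorphism on a cyclic word\<close>

context
  fixes p :: letter and S :: "letter set"
  assumes pS: "p \<notin> S" "linv p \<notin> S"
begin

definition wh_pre :: "letter \<Rightarrow> letter \<Rightarrow> word" where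
  "wh_pre q l = (if l \<in> S then [q] else [])"

text \<open>The multiplier \<open>q\<close> is kept apart from the fixed \<open>p\<close> because
  the inverse automorphism has the multiplier \<open>linv p\<close> and the same
  \<open>S\<close>.\<close>

definition whitehead :: "letter \<Rightarrow> letter \<Rightarrow> word" where
  "whitehead q l = wh_pre q l @ [l] @ winv (wh_pre q (linv l))"

lemma whitehead_ok: "q \<in> Lt n \<Longrightarrow> ok_subst n (whitehead q)"
  unfolding ok_subst_def whitehead_def by (auto simp: wh_pre_def set_winv simp del: split_paired_All)

lemma whitehead_inverse:
  assumes "q = p \<or> q = linv p"
  shows "subst (whitehead (linv q)) (whitehead q l) = [l]"
proof -
  have "whitehead (linv q) q = [q]" "whitehead (linv q) (linv q) = [linv q]"
    using assms pS by (auto simp: whitehead_def wh_pre_def)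
  moreover have "red [l, q, linv q] = [l]" "red [l, linv q, q] = [l]"
    using red_winv_end(3,4)[of "[l]" "[q]"] by simp_all
  ultimately show ?thesis
    by (auto simp: subst_def whitehead_def[of q] wh_pre_def[of q])
      (auto simp: whitehead_def wh_pre_def)
qed

lemma whitehead_iso:
  assumes "p \<in> Lt n"
  shows "subst (whitehead p) \<in> iso (free_grp n) (free_grp n)"
proof (rule subst_iso[where t = "whitehead (linv p)"])
  show "subst (whitehead p) (whitehead (linv p) l) = [l]" for l
    using whitehead_inverse[of "linv p" l] by simp
qed (use assms whitehead_ok whitehead_inverse[of p] in auto)

text \<open>If no turn joins \<open>S\<close> to the complement of \<open>S \<union> {p}\<close>, the Whitehead automorphism amounts, up to
  conjugation, to deleting from the cyclic word all letters \<open>p\<^sup>\<plusminus>\<^sup>1\<close> at turns between \<open>p\<close> and \<open>S\<close>.\<close>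

fun wh_delete :: "letter \<Rightarrow> word \<Rightarrow> letter \<Rightarrow> word" where
  "wh_delete q [] r = []"
| "wh_delete q (a # w) r =
    (if a = linv p \<and> hd (w @ [r]) \<in> S \<or> a = p \<and> linv q \<in> S then [] else [a]) @ wh_delete a w r"

text \<open>\<open>wh_right\<close> and \<open>wh_left\<close> are the leftovers at a junction
  between the images of \<open>q\<close> and \<open>a\<close>. The former cancels against a
  \<open>p\<close> on its right, the latter against a \<open>linv p\<close> on its left.\<close>

definition wh_right :: "letter \<Rightarrow> letter \<Rightarrow> word" where
  "wh_right q a = (if a = p \<and> linv q \<in> S then [linv p] else [])"

definition wh_left :: "letter \<Rightarrow> letter \<Rightarrow> word" where
  "wh_left q a = (if q = linv p \<and> a \<in> S then [p] else [])"

definition wh_good :: "letter \<Rightarrow> letter \<Rightarrow> bool" where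
  "wh_good q a \<longleftrightarrow> \<not> (linv q \<in> S \<and> a \<notin> S \<and> a \<noteq> p) \<and> \<not> (a \<in> S \<and> linv q \<notin> S \<and> q \<noteq> linv p)"

text \<open>Between the images stand a \<open>linv p\<close> if \<open>linv q \<in> S\<close> and a
  \<open>p\<close> if \<open>a \<in> S\<close>. Both together cancel; by \<open>wh_good\<close>,
  just one of them occurs only if the other end of the edge from \<open>linv q\<close> to
  \<open>a\<close> is \<open>p\<close>.\<close>

lemma wh_junction:
  assumes "wh_good q a"
  shows "red (winv (wh_pre p (linv q)) @ wh_pre p a @ z) = red (wh_left q a @ wh_right q a @ z)"
  using assms pS unfolding wh_good_def
  by (cases "linv q \<in> S"; cases "a \<in> S") (auto simp: wh_pre_def wh_left_def wh_right_def)

lemma wh_absorb: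
  assumes "b = hd (w @ [r])"
  shows "red (wh_right q a @ [a] @ wh_left a b @ z)
    = red ((if a = linv p \<and> hd (w @ [r]) \<in> S \<or> a = p \<and> linv q \<in> S then [] else [a]) @ z)"
  using pS unfolding wh_right_def wh_left_def assms[symmetric]
  by (cases "a = p"; cases "a = linv p") auto

text \<open>To make the induction work, half a junction is kept at each end: the parts of the images
  of \<open>q\<close> and \<open>r\<close> that face \<open>w\<close>.\<close>

lemma whitehead_word:
  assumes "successively wh_good (q # w @ [r])"
  shows "red (winv (wh_pre p (linv q)) @ concat (map (whitehead p) w) @ wh_pre p r)
    = red (wh_left q (hd (w @ [r])) @ wh_delete q w r @ wh_right (last (q # w)) r)"
  using assms
proof (induction w arbitrary: q)
  case Nil
  then show ?case using wh_junction[of q r "[]"] by simp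
next
  case (Cons a w)
  let ?b = "hd (w @ [r])"
  let ?T = "wh_delete a w r @ wh_right (last (a # w)) r"
  have good: "wh_good q a" and "successively wh_good (a # w @ [r])" using Cons.prems by auto
  then have IH: "red (winv (wh_pre p (linv a)) @ concat (map (whitehead p) w) @ wh_pre p r) = red (wh_left a ?b @ ?T)"
    using Cons.IH by simp
  have "red (winv (wh_pre p (linv q)) @ concat (map (whitehead p) (a # w)) @ wh_pre p r)
      = red (winv (wh_pre p (linv q)) @ wh_pre p a @ [a] @ winv (wh_pre p (linv a)) @ concat (map (whitehead p) w) @ wh_pre p r)"
    by (simp add: whitehead_def)
  also have "\<dots> = red (wh_left q a @ wh_right q a @ [a] @ winv (wh_pre p (linv a)) @ concat (map (whitehead p) w) @ wh_pre p r)"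
    by (rule wh_junction[OF good])
  also have "\<dots> = red (wh_left q a @ wh_right q a @ [a] @ wh_left a ?b @ ?T)"
    using red_cong_right[OF IH, of "wh_left q a @ wh_right q a @ [a]"] by simp
  also have "\<dots> = red (wh_left q a @ (if a = linv p \<and> ?b \<in> S \<or> a = p \<and> linv q \<in> S then [] else [a]) @ ?T)"
    by (intro red_cong_right wh_absorb refl)
  also have "\<dots> = red (wh_left q (hd ((a # w) @ [r])) @ wh_delete q (a # w) r @ wh_right (last (q # a # w)) r)"
    by simp
  finally show ?case .
qed

lemma length_wh_delete: "length (wh_delete q w r) \<le> length w"
proof (induction w arbitrary: q)
  case (Cons a w)
  then show ?case by (auto intro: le_SucI Cons.IH simp del: split_paired_All)
qed simp

lemma wh_delete_append:
  "wh_delete q (X @ Y) r = wh_delete q X (hd (Y @ [r])) @ wh_delete (last (q # X)) Y r"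
proof (induction X arbitrary: q)
  case (Cons a X)
  have "hd (X @ [hd (Y @ [r])]) = hd (X @ Y @ [r])" by (cases X) auto
  then show ?case using Cons by simp
qed simp

lemma length_wh_delete_less:
  assumes turn: "turn u a b" and ab: "a = linv p \<and> b \<in> S \<or> b = p \<and> linv a \<in> S"
  shows "length (wh_delete (last u) u (hd u)) < length u"
proof -
  obtain P Q where PQ: "u = P @ Q" "P \<noteq> []" "a = last P" "b = hd (Q @ P)"
    using turn by (auto simp: turn_def)
  have *: "length (wh_delete (last u) u (hd u)) < length u"
    if "u = X @ c # Y" "c = linv p \<and> hd (Y @ [hd u]) \<in> S \<or> c = p \<and> linv (last (last u # X)) \<in> S" for X c Y
  proof -
    have "wh_delete (last u) u (hd u) =
        wh_delete (last u) X (hd ((c # Y) @ [hd u])) @ wh_delete (last (last u # X)) (c # Y) (hd u)"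
      unfolding that(1) by (rule wh_delete_append)
    also have "wh_delete (last (last u # X)) (c # Y) (hd u) = wh_delete c Y (hd u)"
      using that(2) by simp
    finally show ?thesis
      using length_wh_delete[of "last u" X "hd ((c # Y) @ [hd u])"] length_wh_delete[of c Y "hd u"] that(1)
      by (metis add_mono_thms_linordered_field(4) length_append length_Cons less_Suc_eq_le)
  qed
  show ?thesis
  proof (cases "a = linv p \<and> b \<in> S")
    case True
    have "u = butlast P @ a # Q" using PQ append_butlast_last_id[of P] by simp
    moreover have "hd (Q @ [hd u]) = b" using PQ by (simp add: hd_append)
    ultimately show ?thesis using * True by blast
  next
    case False
    then have b: "b = p" "linv a \<in> S" using ab by auto
    show ?thesis
    proof (cases Q)
      case Nil
      then show ?thesis using *[of "[]" b "tl u"] PQ b by auto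
    next
      case (Cons c Q')
      then show ?thesis using *[of P b Q'] PQ b by auto
    qed
  qed
qed

lemma whitehead_shortens:
  assumes u: "u \<in> C n" and p: "p \<in> Lt n"
    and good: "\<And>a b. turn u a b \<Longrightarrow> wh_good a b"
    and turn: "turn u a b" and ab: "a = linv p \<and> b \<in> S \<or> b = p \<and> linv a \<in> S"
  shows "\<exists>\<phi>\<in>iso (free_grp n) (free_grp n). length (\<phi> u) < length u"
proof -
  have "u \<noteq> []" using turn by (auto simp: turn_def)
  define q where "q = last u"
  define r where "r = hd u"
  define A where "A = wh_right q r"
  define B where "B = wh_left q r"
  define D where "D = wh_delete q u r"
  define W where "W = concat (map (whitehead p) u)"
  \<comment> \<open>The half junctions at the two ends of \<open>u\<close> belong to one cyclic
    junction, between its last and its first letter. Conjugation by \<open>Z\<close> joins them, and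
    the leftovers \<open>A\<close> and \<open>B\<close> cancel.\<close>
  define Z where "Z = wh_pre p (linv q) @ B"
  have succ: "successively wh_good (q # u @ [r])"
    unfolding q_def r_def using \<open>u \<noteq> []\<close> good by (rule successively_turns)
  have W: "red (winv (wh_pre p (linv q)) @ W @ wh_pre p r) = red (B @ D @ A)"
    using whitehead_word[OF succ] \<open>u \<noteq> []\<close> by (simp add: W_def A_def B_def D_def q_def r_def)
  have "turn u q r"
    unfolding turn_def q_def r_def using \<open>u \<noteq> []\<close> by (intro exI[of _ u] exI[of _ "[]"]) auto
  then have J: "red (winv (wh_pre p (linv q)) @ wh_pre p r @ z) = red (B @ A @ z)" for z
    unfolding A_def B_def by (intro wh_junction good)
  have AJ: "red (winv (wh_pre p r) @ wh_pre p (linv q) @ B) = red (winv A)"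
  proof -
    let ?X = "winv (wh_pre p r) @ wh_pre p (linv q)"
    have "red (?X @ B) = red (?X @ B @ A @ winv A)"
      using red_winv_end(4)[of "?X @ B" A] by simp
    also have "\<dots> = red (?X @ winv (wh_pre p (linv q)) @ wh_pre p r @ winv A)"
      by (intro red_cong_right J[symmetric])
    also have "\<dots> = red (winv (wh_pre p r) @ wh_pre p r @ winv A)"
      using red_cong_right[OF red_winv_cancel'[of "wh_pre p (linv q)" "wh_pre p r @ winv A"], of "winv (wh_pre p r)"]
      by simp
    also have "\<dots> = red (winv A)" by (rule red_winv_cancel)
    finally show ?thesis by simp
  qed
  have "red (winv Z @ W @ Z) = red D"
  proof -
    let ?V = "winv (wh_pre p (linv q))"
    have "red (winv Z @ W @ Z) = red ((winv B @ ?V @ W) @ wh_pre p (linv q) @ B)"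
      by (simp add: Z_def)
    also have "\<dots> = red ((winv B @ ?V @ W) @ wh_pre p r @ winv (wh_pre p r) @ wh_pre p (linv q) @ B)"
      by (intro red_cong_right red_winv_cancel'[symmetric])
    also have "\<dots> = red (winv B @ (?V @ W @ wh_pre p r) @ winv A)"
      using red_cong_right[OF AJ, of "winv B @ ?V @ W @ wh_pre p r"] by simp
    also have "\<dots> = red (winv B @ (B @ D @ A) @ winv A)"
      by (intro red_cong_right red_cong_left W)
    also have "\<dots> = red (D @ A @ winv A)"
      using red_winv_cancel[of B "D @ A @ winv A"] by simp
    finally show ?thesis by simp
  qed
  moreover have Z: "set Z \<subseteq> Lt n"
    using p by (auto simp: Z_def wh_pre_def B_def wh_left_def)
  have "fw_mult (winv (red Z)) (fw_mult (subst (whitehead p) u) (red Z)) = red (winv Z @ W @ Z)"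
  proof -
    have "winv (red Z) = red (winv Z)"
      using winv_mult[of Z "[]"] by (simp add: fw_mult_def)
    then show ?thesis by (simp add: fw_mult_def subst_def W_def)
  qed
  ultimately have eq: "((\<lambda>x. fw_mult (winv (red Z)) (fw_mult x (red Z))) \<circ> subst (whitehead p)) u = red D"
    by simp
  have "length (red D) < length u"
    using length_red[of D] length_wh_delete_less[OF turn ab] by (simp add: D_def q_def r_def)
  moreover have "(\<lambda>x. fw_mult (winv (red Z)) (fw_mult x (red Z))) \<circ> subst (whitehead p) \<in> iso (free_grp n) (free_grp n)"
    using whitehead_iso[OF p] conj_iso[OF red_carrier[OF Z]]
      iso_set_trans by blast
  ultimately show ?thesis using eq by metis
qed

end

section \<open>Minimal length in the automorphism orbit\<close>

definition aut_minimal :: "nat \<Rightarrow> word \<Rightarrow> bool" where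
  "aut_minimal n u \<longleftrightarrow> u \<in> C n \<and> (\<forall>\<phi>\<in>iso (free_grp n) (free_grp n). length u \<le> length (\<phi> u))"

text \<open>Otherwise a conjugation would cancel a letter at each end.\<close>

lemma aut_minimal_cyc_reduced:
  assumes "aut_minimal n u"
  shows "cyc_reduced u"
proof (rule ccontr)
  assume neg: "\<not> cyc_reduced u"
  have u: "u \<in> C n" and min: "\<And>\<phi>. \<phi> \<in> iso (free_grp n) (free_grp n) \<Longrightarrow> length u \<le> length (\<phi> u)"
    using assms by (auto simp: aut_minimal_def)
  have ne: "u \<noteq> []" "hd u = linv (last u)" "reduced u"
    using neg u by (auto simp: cyc_reduced_def reduced_append carrier_iff)
  obtain w l where ul: "u = w @ [l]" using ne(1) by (cases u rule: rev_cases) auto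
  obtain v where w: "w = linv l # v" using ne ul by (cases w) auto
  have l: "winv [l] \<in> C n" "[linv l] \<in> C n" using u by (auto simp: carrier_iff ul)
  have "fw_mult [l] (fw_mult u [linv l]) = red v"
    using red_winv_end(4)[of v "[l]"] by (simp add: fw_mult_def ul w) 
  then have "length (fw_mult (winv [linv l]) (fw_mult u [linv l])) < length u"
    using length_red[of v] by (simp add: ul w)
  then show False using min[OF conj_iso[OF l(2)]] by simp
qed

text \<open>The Whitehead graph with vertex set \<open>Lt n\<close> and an edge between \<open>linv a\<close> and \<open>b\<close>
  for each turn remains connected after the removal of any vertex.\<close>

definition no_cut_vertex :: "nat \<Rightarrow> word \<Rightarrow> bool" where
  "no_cut_vertex n u \<longleftrightarrow> (\<forall>p\<in>Lt n. \<forall>S. S \<subseteq> Lt n - {p} \<longrightarrow> S \<noteq> {} \<longrightarrow> S \<noteq> Lt n - {p} \<longrightarrow>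
     (\<exists>a b. turn u a b \<and> linv a \<noteq> p \<and> b \<noteq> p \<and> (linv a \<in> S \<longleftrightarrow> b \<notin> S)))"

text \<open>A turn between \<open>p\<close> and \<open>S\<close> would be shortened by the Whitehead
  automorphism. So a set that only \<open>p\<close> could link to the rest of the Whitehead graph is
  not linked to it at all.\<close>

lemma aut_minimal_wh_good:
  assumes min: "aut_minimal n u" and p: "p \<in> Lt n" "p \<notin> S" "linv p \<notin> S"
    and good: "\<And>a b. turn u a b \<Longrightarrow> linv a \<noteq> p \<Longrightarrow> b \<noteq> p \<Longrightarrow> linv a \<in> S \<longleftrightarrow> b \<in> S"
    and turn: "turn u a b"
  shows "linv a \<in> S \<longleftrightarrow> b \<in> S"
proof -
  have u: "u \<in> C n" and no: "\<not> (\<exists>\<phi>\<in>iso (free_grp n) (free_grp n). length (\<phi> u) < length u)"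
    using min by (auto simp: aut_minimal_def not_less)
  have g: "wh_good p S a b" if "turn u a b" for a b
    using good[OF that] p(2) linv_eq_iff[of a p] unfolding wh_good_def[OF p(2,3)] by metis
  have "\<not> (a = linv p \<and> b \<in> S \<or> b = p \<and> linv a \<in> S)"
    using whitehead_shortens[OF p(2,3) u p(1) g turn] no by blast
  then show ?thesis using good[OF turn] p(2) linv_eq_iff[of a p] by metis
qed

lemma aut_minimal_no_cut_vertex:
  assumes sep: "separating n u" and min: "aut_minimal n u"
  shows "no_cut_vertex n u"
  unfolding no_cut_vertex_def
proof (intro ballI allI impI, rule ccontr)
  fix p S assume p: "p \<in> Lt n" and S: "S \<subseteq> Lt n - {p}" "S \<noteq> {}" "S \<noteq> Lt n - {p}"
    and neg: "\<not> (\<exists>a b. turn u a b \<and> linv a \<noteq> p \<and> b \<noteq> p \<and> (linv a \<in> S \<longleftrightarrow> b \<notin> S))"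
  have u: "u \<in> C n" using min by (simp add: aut_minimal_def)
  have cyc: "cyc_reduced u" using min by (rule aut_minimal_cyc_reduced)
  have full: "i \<in> fst ` set u" if "i < n" for i using separating_full_support[OF sep that] .
  \<comment> \<open>The Whitehead automorphism needs \<open>linv p\<close> outside its set, so the
    other side of the cut is taken if necessary. By minimality \<open>T\<close> is then a union of
    components of the Whitehead graph.\<close>
  define T where "T = (if linv p \<in> S then Lt n - {p} - S else S)"
  have T: "T \<subseteq> Lt n" "p \<notin> T" "linv p \<notin> T" "T \<noteq> {}"
    using S by (auto simp: T_def)
  have turn_Lt: "linv a \<in> Lt n \<and> b \<in> Lt n" if "turn u a b" for a b
    using turn_set[OF that] u by (auto simp: carrier_iff)
  have "linv a \<in> T \<longleftrightarrow> b \<in> T" if "turn u a b" "linv a \<noteq> p" "b \<noteq> p" for a b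
  proof -
    have "linv a \<in> S \<longleftrightarrow> b \<in> S" using neg that by blast
    then show ?thesis using that turn_Lt[OF that(1)] by (auto simp: T_def)
  qed
  then have closed: "linv a \<in> T \<longleftrightarrow> b \<in> T" if "turn u a b" for a b
    using aut_minimal_wh_good[OF min p T(2,3) _ that] by blast
  show False
  proof (cases "\<exists>s\<in>T. linv s \<notin> T")
    \<comment> \<open>Now \<open>s\<close> serves as cut vertex with \<open>T - {s}\<close> as one
      side. Since \<open>T\<close> and \<open>T - {s}\<close> are both closed under edges,
      \<open>s\<close> is isolated, although \<open>s\<close> or its inverse occurs in
      \<open>u\<close>.\<close>
    case True
    then obtain s where s: "s \<in> T" "linv s \<notin> T" by blast
    have sC: "s \<in> Lt n" using s T by auto
    have eq: "linv a \<in> T - {s} \<longleftrightarrow> b \<in> T - {s}" if "turn u a b" for a b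
    proof (rule aut_minimal_wh_good[OF min sC _ _ _ that])
      show "linv a \<in> T - {s} \<longleftrightarrow> b \<in> T - {s}" if "turn u a b" "linv a \<noteq> s" "b \<noteq> s" for a b
        using closed[OF that(1)] that by auto
    qed (use s in auto)
    then have no_turn: "linv a \<noteq> s \<and> b \<noteq> s" if "turn u a b" for a b
      using eq[OF that] closed[OF that] turn_reduced[OF cyc that] s(1) by blast
    have "s \<in> set u \<or> linv s \<in> set u"
      using letter_or_inverse[OF full[of "fst s"]] sC by simp
    then show False
      using no_turn turn_prev[of s u] turn_next[of "linv s" u] by fastforce
  next
    case False
    \<comment> \<open>With \<open>T\<close> closed under inverses, membership in \<open>T\<close> is
      constant along the cyclic word \<open>u\<close>. But all generators occur in \<open>u\<close>,
      and some of them lie in \<open>T\<close> while that of \<open>p\<close> does not.\<close>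
    then have Tinv: "linv s \<in> T \<longleftrightarrow> s \<in> T" for s by (metis linv_linv)
    have step: "a \<in> T \<longleftrightarrow> b \<in> T" if "turn u a b" for a b
      using closed[OF that] Tinv by simp
    have "u \<noteq> []" using full[of "fst p"] p by auto
    have all: "l \<in> T \<longleftrightarrow> last u \<in> T" if "l \<in> set u" for l
      using successively_const[OF successively_turns[OF \<open>u \<noteq> []\<close>, of "\<lambda>a b. a \<in> T \<longleftrightarrow> b \<in> T"], of l] step that
      by (simp del: split_paired_All)
    have in_u: "\<exists>l\<in>set u. l \<in> T \<longleftrightarrow> s \<in> T" if "s \<in> Lt n" for s
      using letter_or_inverse[OF full[of "fst s"]] that Tinv by blast
    obtain s where "s \<in> T" using T by blast
    then have "s \<in> Lt n" using T(1) by blast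
    obtain l where l: "l \<in> set u" "l \<in> T" using in_u[OF \<open>s \<in> Lt n\<close>] \<open>s \<in> T\<close> by (elim bexE) simp
    obtain k where k: "k \<in> set u" "k \<notin> T" using in_u[OF p] T(2) by (elim bexE) simp
    show False using all[OF l(1)] all[OF k(1)] l(2) k(2) by simp
  qed
qed

section \<open>Translates of the axis in the Cayley tree\<close>

abbreviation pw :: "word \<Rightarrow> nat \<Rightarrow> word" where
  "pw u k \<equiv> concat (replicate k u)"

lemma pw_comm: "pw u k @ u = u @ pw u k"
  by (induction k) auto

lemma pw_Suc2: "pw u (Suc k) = pw u k @ u"
  by (simp add: pw_comm)

lemma winv_pw: "winv (pw u k) = pw (winv u) k"
  by (induction k) (auto simp: pw_comm)

lemma length_pw: "length (pw u k) = k * length u"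
  by (induction k) auto

lemma set_pw: "set (pw u k) \<subseteq> set u"
  by (induction k) auto

lemma reduced_pw:
  assumes "cyc_reduced u"
  shows "reduced (pw u k)"
proof (cases "u = []")
  case False
  have "reduced (pw u k) \<and> (k > 0 \<longrightarrow> hd (pw u k) = hd u)"
  proof (induction k)
    case (Suc k)
    then show ?case using assms False
      by (cases k) (auto simp: reduced_append cyc_reduced_def)
  qed simp
  then show ?thesis ..
next
  case True
  then show ?thesis by (induction k) auto
qed

text \<open>With \<open>u = P Q\<close>, these are the vertices \<open>g P\<inverse> u\<^sup>j\<close> for \<open>j = k + 1\<close> and for \<open>j = - k\<close>.\<close>

definition line_pos :: "word \<Rightarrow> word \<Rightarrow> word \<Rightarrow> nat \<Rightarrow> word" where
  "line_pos g P Q k = g @ Q @ pw (P @ Q) k"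

definition line_neg :: "word \<Rightarrow> word \<Rightarrow> word \<Rightarrow> nat \<Rightarrow> word" where
  "line_neg g P Q k = g @ winv (pw (P @ Q) k @ P)"

lemma reduced_line:
  assumes "cyc_reduced (P @ Q)"
  shows "reduced (Q @ pw (P @ Q) k)" "reduced (winv (pw (P @ Q) k @ P))"
proof -
  have "reduced (pw (P @ Q) (Suc k))" by (rule reduced_pw[OF assms])
  then show "reduced (Q @ pw (P @ Q) k)"
    using reduced_append[of P "Q @ pw (P @ Q) k"] by simp
  have "reduced (pw (P @ Q) (Suc k))" by (rule reduced_pw[OF assms])
  then have "reduced ((pw (P @ Q) k @ P) @ Q)" unfolding pw_Suc2 by simp
  then have "reduced (pw (P @ Q) k @ P)" unfolding reduced_append[of _ Q] by simp
  then show "reduced (winv (pw (P @ Q) k @ P))" by (simp only: reduced_winv)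
qed

lemma line_step:
  assumes "line_pos g P Q (Suc k) \<in> C n"
  shows "fw_mult (line_pos g P Q k) (P @ Q) = line_pos g P Q (Suc k)"
  using assms by (simp add: fw_mult_def line_pos_def pw_comm carrier_iff)

lemma line_step_0:
  assumes "line_pos g P Q 0 \<in> C n"
  shows "fw_mult (line_neg g P Q 0) (P @ Q) = line_pos g P Q 0"
proof -
  have "red ((g @ winv P) @ P @ Q) = red (g @ red (winv P @ P @ Q))" by simp
  then have "red ((g @ winv P) @ P @ Q) = red (g @ Q)" by (simp only: red_winv_cancel red_append_right)
  then show ?thesis using assms by (simp add: fw_mult_def line_pos_def line_neg_def carrier_iff)
qed

lemma line_step_neg:
  assumes "line_neg g P Q k \<in> C n"
  shows "fw_mult (line_neg g P Q (Suc k)) (P @ Q) = line_neg g P Q k"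
proof -
  let ?v = "winv (pw (P @ Q) k @ P)"
  have "winv (pw (P @ Q) (Suc k) @ P) = ?v @ winv (P @ Q)"
    by (simp add: winv_pw pw_comm)
  then have "red ((g @ winv (pw (P @ Q) (Suc k) @ P)) @ P @ Q) = red ((g @ ?v) @ winv (P @ Q) @ P @ Q)"
    by simp
  also have "\<dots> = red (g @ ?v)" by (rule red_winv_end(3))
  finally show ?thesis using assms by (simp add: fw_mult_def line_neg_def carrier_iff)
qed

lemma line_const:
  fixes \<psi> :: "word \<Rightarrow> int"
  assumes C: "\<And>k. line_pos g P Q k \<in> C n" "\<And>k. line_neg g P Q k \<in> C n"
    and pos: "\<And>k. \<psi> (fw_mult (line_pos g P Q k) (P @ Q)) = \<psi> (line_pos g P Q k)"
    and neg: "\<And>k. \<psi> (fw_mult (line_neg g P Q k) (P @ Q)) = \<psi> (line_neg g P Q k)"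
  shows "\<psi> (line_pos g P Q j) = \<psi> (line_neg g P Q k)"
proof -
  have "\<psi> (line_pos g P Q j) = \<psi> (line_pos g P Q 0)"
    by (induction j) (use pos line_step[OF C(1)] in auto)
  moreover have "\<psi> (line_neg g P Q k) = \<psi> (line_neg g P Q 0)"
  proof (induction k)
    case (Suc k)
    then show ?case using neg[of "Suc k"] line_step_neg[OF C(2), of k] by simp
  qed simp
  ultimately show ?thesis using neg[of 0] line_step_0[OF C(1)] by simp
qed

text \<open>By the hypothesis on turns neither half of the line starts back along the last letter of
  \<open>g\<close>. So the concatenations are already reduced, and the line passes through
  \<open>g\<close>.\<close>

lemma line_carrier:
  assumes u: "P @ Q \<in> C n" "cyc_reduced (P @ Q)" and g: "g \<in> C n"
    and turn: "g = [] \<or> P \<noteq> [] \<and> last g \<noteq> last P \<and> hd (Q @ P) \<noteq> linv (last g)"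
  shows "line_pos g P Q k \<in> C n" "line_neg g P Q k \<in> C n"
proof -
  have "reduced (line_pos g P Q k)"
  proof (cases "g = [] \<or> Q @ pw (P @ Q) k = []")
    case True
    then show ?thesis using g reduced_line(1)[OF u(2)] by (auto simp: line_pos_def carrier_iff)
  next
    case False
    have "hd (Q @ pw (P @ Q) k) = hd (Q @ P)"
      using turn False by (cases k) (auto simp: hd_append)
    then show ?thesis using False turn g reduced_line(1)[OF u(2), of k]
      unfolding line_pos_def by (subst reduced_append) (auto simp: carrier_iff)
  qed
  then show "line_pos g P Q k \<in> C n"
    using u(1) g set_pw[of k "P @ Q"] by (auto simp: carrier_iff line_pos_def)
  have "reduced (line_neg g P Q k)"
  proof (cases "g = []")
    case True
    then show ?thesis using reduced_line(2)[OF u(2)] by (auto simp: line_neg_def)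
  next
    case False
    then have "hd (winv (pw (P @ Q) k @ P)) = linv (last P)"
      using turn by (subst hd_winv) auto
    then show ?thesis using False turn g reduced_line(2)[OF u(2), of k]
      unfolding line_neg_def by (subst reduced_append) (auto simp: carrier_iff)
  qed
  moreover have "set (winv (pw (P @ Q) k @ P)) \<subseteq> Lt n"
    unfolding set_winv using u(1) set_pw[of k "P @ Q"] by (auto simp: carrier_iff)
  ultimately show "line_neg g P Q k \<in> C n"
    using g by (auto simp: carrier_iff line_neg_def)
qed

text \<open>For reduced \<open>g @ [b]\<close>, the branch of the Cayley tree beyond the edge from
  \<open>g\<close> to \<open>g @ [b]\<close>.\<close>

definition cone :: "word \<Rightarrow> letter \<Rightarrow> word set" where
  "cone g b = {v. \<exists>w. v = g @ b # w}"

lemma line_pos_cone: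
  assumes "P \<noteq> []"
  shows "line_pos g P Q k \<in> insert g (cone g (hd (Q @ P)))"
    "k > 0 \<Longrightarrow> line_pos g P Q k \<in> cone g (hd (Q @ P))"
proof -
  have *: "line_pos g P Q k \<in> cone g (hd (Q @ P))" if "Q @ pw (P @ Q) k \<noteq> []"
  proof -
    have "hd (Q @ pw (P @ Q) k) = hd (Q @ P)"
      using that assms by (cases k) (auto simp: hd_append)
    then have "Q @ pw (P @ Q) k = hd (Q @ P) # tl (Q @ pw (P @ Q) k)"
      using that by (metis list.collapse)
    then show ?thesis unfolding cone_def line_pos_def by blast
  qed
  show "k > 0 \<Longrightarrow> line_pos g P Q k \<in> cone g (hd (Q @ P))"
    using assms by (intro *) (cases k, auto)
  show "line_pos g P Q k \<in> insert g (cone g (hd (Q @ P)))"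
    using * by (cases "Q @ pw (P @ Q) k = []") (auto simp: line_pos_def)
qed

lemma line_neg_cone:
  assumes "P \<noteq> []"
  shows "line_neg g P Q k \<in> cone g (linv (last P))"
proof -
  have "hd (winv (pw (P @ Q) k @ P)) = linv (last P)"
    using assms by (subst hd_winv) auto
  moreover have "winv (pw (P @ Q) k @ P) \<noteq> []" using assms by simp
  ultimately have "winv (pw (P @ Q) k @ P) = linv (last P) # tl (winv (pw (P @ Q) k @ P))"
    by (metis list.collapse)
  then show ?thesis unfolding cone_def line_neg_def by blast
qed

lemma length_line:
  assumes "P @ Q \<noteq> []"
  shows "k \<le> length (line_pos g P Q k)" "k \<le> length (line_neg g P Q k)"
proof -
  have "k \<le> length (pw (P @ Q) k)"
    using assms unfolding length_pw by (cases "length (P @ Q)") auto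
  then show "k \<le> length (line_pos g P Q k)" "k \<le> length (line_neg g P Q k)"
    by (auto simp: line_pos_def line_neg_def winv_def)
qed

section \<open>Constancy near the ends of a branch\<close>

definition tame :: "nat \<Rightarrow> (word \<Rightarrow> int) \<Rightarrow> nat \<Rightarrow> bool" where
  "tame n \<psi> N \<longleftrightarrow> (\<forall>h l. h @ [l] \<in> C n \<longrightarrow> N \<le> length h \<longrightarrow> \<psi> (h @ [l]) = \<psi> h)"

context
  fixes n :: nat and u :: word and \<psi> :: "word \<Rightarrow> int" and N :: nat
  assumes u: "u \<in> C n" "cyc_reduced u" "u \<noteq> []"
    and no_cut: "no_cut_vertex n u"
    and far: "tame n \<psi> N"
begin

definition far_const :: "word set \<Rightarrow> int \<Rightarrow> bool" where
  "far_const A c \<longleftrightarrow> (\<forall>w\<in>A \<inter> C n. N \<le> length w \<longrightarrow> \<psi> w = c)"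

text \<open>Translates of the axis through \<open>g\<close> link the branches at \<open>g\<close> as
  the Whitehead graph links letters. Without the vertex \<open>y\<close>, the way back from
  \<open>g\<close>, the graph is still connected, so the constants of the other branches agree.
  \<open>R\<close> is a region within which steps by \<open>u\<close> do not change \<psi>; the
  lines used stay inside it. At the root any \<open>y\<close> may be left out.\<close>

lemma far_const_merge:
  assumes g: "g \<in> C n" and y: "y \<in> Lt n" "g \<noteq> [] \<Longrightarrow> y = linv (last g)"
    and children: "\<And>b. b \<in> Lt n \<Longrightarrow> b \<noteq> y \<Longrightarrow> \<exists>c. far_const (cone g b) c"
    and R: "insert g (\<Union>b\<in>Lt n - {y}. cone g b) \<subseteq> R"
    and avoid: "\<And>v. v \<in> C n \<Longrightarrow> v \<in> R \<Longrightarrow> fw_mult v u \<in> R \<Longrightarrow> \<psi> (fw_mult v u) = \<psi> v"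
  shows "\<exists>c. far_const (\<Union>b\<in>Lt n - {y}. cone g b) c"
proof -
  obtain c where c: "\<And>b. b \<in> Lt n \<Longrightarrow> b \<noteq> y \<Longrightarrow> far_const (cone g b) (c b)"
    using children by metis
  have eq: "c b = c b0" if b: "b \<in> Lt n" "b \<noteq> y" "b0 \<in> Lt n" "b0 \<noteq> y" for b b0
  proof (rule ccontr)
    assume ne: "c b \<noteq> c b0"
    define S where "S = {b \<in> Lt n - {y}. c b = c b0}"
    have "b0 \<in> S" "b \<notin> S" "b \<in> Lt n - {y}" using b ne by (simp_all add: S_def)
    moreover have "S \<subseteq> Lt n - {y}" unfolding S_def by blast
    ultimately have "S \<subseteq> Lt n - {y}" "S \<noteq> {}" "S \<noteq> Lt n - {y}" by blast+
    then obtain a d where turn: "turn u a d" "linv a \<noteq> y" "d \<noteq> y" "linv a \<in> S \<longleftrightarrow> d \<notin> S"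
      using no_cut y(1) unfolding no_cut_vertex_def by blast
    obtain P Q where PQ: "u = P @ Q" "P \<noteq> []" "a = last P" "d = hd (Q @ P)"
      using turn(1) by (auto simp: turn_def)
    have Lt: "linv a \<in> Lt n" "d \<in> Lt n"
      using turn_set[OF turn(1)] u(1) by (auto simp: carrier_iff)
    have line: "line_pos g P Q k \<in> C n" "line_neg g P Q k \<in> C n" for k
    proof -
      have "g = [] \<or> P \<noteq> [] \<and> last g \<noteq> last P \<and> hd (Q @ P) \<noteq> linv (last g)"
        using turn y(2) PQ by auto
      then show "line_pos g P Q k \<in> C n" "line_neg g P Q k \<in> C n"
        using line_carrier[of P Q n g k] u g PQ(1) by auto
    qed
    have R_pos: "line_pos g P Q k \<in> R" for k
      using line_pos_cone(1)[OF PQ(2), of g Q k] R Lt turn PQ by blast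
    have R_neg: "line_neg g P Q k \<in> R" for k
      using line_neg_cone[OF PQ(2), of g Q k] R Lt turn PQ by blast
    \<comment> \<open>A positive index puts the point strictly inside its branch, and by
      \<open>length_line\<close> an index of at least \<open>N\<close> makes it long enough for the
      constant to apply.\<close>
    have "\<psi> (line_pos g P Q (Suc N)) = \<psi> (line_neg g P Q (Suc N))"
    proof (rule line_const[OF line])
      show "\<psi> (fw_mult (line_pos g P Q k) (P @ Q)) = \<psi> (line_pos g P Q k)" for k
        using avoid[OF line(1)] R_pos line_step[OF line(1)] PQ(1) by metis
      show "\<psi> (fw_mult (line_neg g P Q k) (P @ Q)) = \<psi> (line_neg g P Q k)" for k
        using avoid[OF line(2)] R_pos R_neg line_step_0[OF line(1)] line_step_neg[OF line(2)] PQ(1)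
        by (cases k) metis+
    qed
    moreover have "\<psi> (line_pos g P Q (Suc N)) = c d"
      using c[OF Lt(2) turn(3)] line_pos_cone(2)[OF PQ(2), of "Suc N" g Q] line(1)[of "Suc N"] PQ u(3)
        length_line(1)[of P Q "Suc N" g]
      by (auto simp: far_const_def)
    moreover have "\<psi> (line_neg g P Q (Suc N)) = c (linv a)"
      using c[OF Lt(1) turn(2)] line_neg_cone[OF PQ(2), of g Q "Suc N"] line(2)[of "Suc N"] PQ u(3)
        length_line(2)[of P Q "Suc N" g]
      by (auto simp: far_const_def)
    ultimately have "c d = c (linv a)" by simp
    then show False using turn Lt by (auto simp: S_def)
  qed
  show ?thesis
  proof (cases "Lt n - {y} = {}")
    case True
    then show ?thesis unfolding True far_const_def by simp
  next
    case False
    then obtain b0 where b0: "b0 \<in> Lt n" "b0 \<noteq> y" by blast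
    have "\<psi> w = c b0" if w: "w \<in> cone g b" "b \<in> Lt n - {y}" "w \<in> C n" "N \<le> length w" for b w
    proof -
      have "\<psi> w = c b" using c[of b] w by (auto simp: far_const_def)
      then show ?thesis using eq[of b b0] w(2) b0 by simp
    qed
    then have "far_const (\<Union>b\<in>Lt n - {y}. cone g b) (c b0)"
      unfolding far_const_def by blast
    then show ?thesis ..
  qed
qed

lemma far_const_extend:
  assumes "h @ w \<in> C n" "N \<le> length h"
  shows "\<psi> (h @ w) = \<psi> h"
  using assms
proof (induction w rule: rev_induct)
  case (snoc l w)
  have "h @ w \<in> C n" using snoc.prems(1) take_carrier[of "h @ w @ [l]" n "length (h @ w)"] by simp
  then show ?case using snoc far unfolding tame_def by (metis append_assoc length_append trans_le_add1)
qed simp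

text \<open>Induction from the ends inwards: beyond length \<open>N\<close> tameness suffices, and
  closer to the root the branches behind \<open>g @ [b]\<close> merge, where the way back is
  \<open>linv b\<close>.\<close>

lemma far_const_cone:
  assumes "g @ [b] \<in> C n" and R: "cone g b \<subseteq> R"
    and avoid: "\<And>v. v \<in> C n \<Longrightarrow> v \<in> R \<Longrightarrow> fw_mult v u \<in> R \<Longrightarrow> \<psi> (fw_mult v u) = \<psi> v"
  shows "\<exists>c. far_const (cone g b) c"
  using assms(1) R
proof (induction "N - length g" arbitrary: g b rule: less_induct)
  case less
  show ?case
  proof (cases "N \<le> length g")
    case True
    have "\<psi> w = \<psi> (g @ [b])" if "w \<in> cone g b" "w \<in> C n" for w
      using that True far_const_extend[of "g @ [b]"] by (auto simp: cone_def)
    then show ?thesis unfolding far_const_def by blast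
  next
    case False
    have b: "linv b \<in> Lt n" using less.prems(1) by (auto simp: carrier_iff)
    have "\<exists>c. far_const (\<Union>d\<in>Lt n - {linv b}. cone (g @ [b]) d) c"
    proof (rule far_const_merge[OF less.prems(1) b _ _ _ avoid])
      fix d assume d: "d \<in> Lt n" "d \<noteq> linv b"
      have "(g @ [b]) @ [d] \<in> C n"
        using less.prems(1) d by (auto simp: carrier_iff reduced_append)
      moreover have "cone (g @ [b]) d \<subseteq> R" using less.prems(2) by (auto simp: cone_def)
      moreover have "N - length (g @ [b]) < N - length g" using False by simp
      ultimately show "\<exists>c. far_const (cone (g @ [b]) d) c" using less.hyps by blast
    next
      show "insert (g @ [b]) (\<Union>d\<in>Lt n - {linv b}. cone (g @ [b]) d) \<subseteq> R"
        using less.prems(2) by (auto simp: cone_def)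
    qed simp
    then obtain c where c: "far_const (\<Union>d\<in>Lt n - {linv b}. cone (g @ [b]) d) c" ..
    have "\<psi> w = c" if w: "w \<in> cone g b" "w \<in> C n" "N \<le> length w" "w \<noteq> g @ [b]" for w
    proof -
      obtain v where v: "w = g @ b # v" using w(1) by (auto simp: cone_def)
      then obtain d v' where v': "v = d # v'" using w(4) by (cases v) auto
      have "reduced (b # d # v')" "d \<in> Lt n"
        using w(2) v v' by (auto simp: carrier_iff reduced_append)
      then have "w \<in> (\<Union>d\<in>Lt n - {linv b}. cone (g @ [b]) d)"
        using v v' by (auto simp: cone_def)
      then show ?thesis using c w unfolding far_const_def by blast
    qed
    note * = this
    have bC: "b \<in> Lt n" "b \<noteq> linv b" using b by simp_all
    \<comment> \<open>The merged branches miss their root \<open>g @ [b]\<close>, which matters if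
      its length is exactly \<open>N\<close>. Tameness then compares it with its continuation by
      \<open>b\<close>, which is reduced.\<close>
    have "\<psi> (g @ [b]) = c" if "N \<le> length (g @ [b])"
    proof -
      have bb: "(g @ [b]) @ [b] \<in> C n"
        using less.prems(1) bC by (auto simp: carrier_iff reduced_append)
      have "\<psi> ((g @ [b]) @ [b]) = c"
        using bb that by (intro *) (auto simp: cone_def)
      then show ?thesis using far bb that unfolding tame_def by metis
    qed
    then have "far_const (cone g b) c" using * unfolding far_const_def by blast
    then show ?thesis ..
  qed
qed

end

section \<open>Translates of the axis that cross an edge\<close>

lemma separating_far:
  assumes fin: "\<And>g. g \<in> C n \<Longrightarrow> finite {h \<in> C n. \<psi> (fw_mult h g) \<noteq> \<psi> h}"
  obtains N where "tame n \<psi> N"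
proof -
  define A where "A = (\<Union>l\<in>Lt n. {h \<in> C n. \<psi> (fw_mult h [l]) \<noteq> \<psi> h})"
  have "Lt n = {..<n} \<times> UNIV" by auto
  then have "finite (Lt n)" by simp
  then have "finite A" unfolding A_def using fin by (intro finite_UN_I) (auto simp: carrier_iff)
  define N where "N = Suc (Max (insert 0 (length ` A)))"
  have "\<psi> (h @ [l]) = \<psi> h" if hl: "h @ [l] \<in> C n" "N \<le> length h" for h l
  proof (rule ccontr)
    assume "\<psi> (h @ [l]) \<noteq> \<psi> h"
    moreover have "h \<in> C n" "l \<in> Lt n"
      using take_carrier[OF hl(1), of "length h"] hl(1) by (auto simp: carrier_iff)
    moreover have "fw_mult h [l] = h @ [l]" using hl(1) by (simp add: fw_mult_def carrier_iff)
    ultimately have "h \<in> A" unfolding A_def by (metis (mono_tags, lifting) UN_I mem_Collect_eq)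
    then have "length h \<le> Max (insert 0 (length ` A))" using \<open>finite A\<close> by simp
    then show False using hl(2) by (simp add: N_def)
  qed
  then have "tame n \<psi> N" unfolding tame_def by blast
  then show ?thesis by (rule that)
qed

text \<open>The edge is the one from \<open>[]\<close> to \<open>[x]\<close>. An occurrence of
  \<open>x\<close> in \<open>u\<close> gives a translate that crosses it towards \<open>[x]\<close>,
  an occurrence of \<open>linv x\<close> one that crosses it the other way and so meets neither jump
  of \<psi>.\<close>

lemma positive_occurrence_unique:
  assumes sep: "separating n u" and cyc: "cyc_reduced u" and no_cut: "no_cut_vertex n u"
    and u1: "u = P1 @ x # Q1" and u2: "u = P2 @ x # Q2" and u3: "u = P3 @ linv x # Q3"
  shows "P1 = P2"
proof (rule ccontr)
  assume "P1 \<noteq> P2"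
  have u: "u \<in> C n" using sep by (simp add: separating_def)
  have ne: "u \<noteq> []" using u1 by simp
  have x: "x \<in> Lt n" using u by (auto simp: carrier_iff u1)
  \<comment> \<open>Reading \<open>u\<close> from here reaches \<open>[]\<close> after
    \<open>P1\<close> and then crosses the edge with the letter \<open>x\<close>.\<close>
  define h1 where "h1 = winv P1"
  define h2 where "h2 = winv P2"
  have "P1 \<in> C n" using take_carrier[OF u, of "length P1"] u1 by simp
  moreover have "P2 \<in> C n" using take_carrier[OF u, of "length P2"] by (simp add: u2)
  ultimately have h: "h1 \<in> C n" "h2 \<in> C n" by (auto simp: h1_def h2_def)
  have h12: "h1 \<noteq> h2" using \<open>P1 \<noteq> P2\<close> by (metis h1_def h2_def winv_simps(4))
  obtain \<psi> :: "word \<Rightarrow> int" where fin: "\<And>g. g \<in> C n \<Longrightarrow> finite {h \<in> C n. \<psi> (fw_mult h g) \<noteq> \<psi> h}"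
    and eq: "\<And>h. h \<in> C n \<Longrightarrow> \<psi> (fw_mult h u) - \<psi> h = of_bool (h = h1) - of_bool (h = h2)"
    using separatingE[OF sep h] by blast
  obtain N where far: "tame n \<psi> N"
    using separating_far[OF fin] by blast
  define R where "R = cone [] x"
  have R_iff: "v \<in> R \<longleftrightarrow> v \<noteq> [] \<and> hd v = x" for v
    by (cases v) (auto simp: R_def cone_def)
  have cross: "h \<notin> R \<and> fw_mult h u \<in> R" if hP: "h = winv P" and uP: "u = P @ x # Q" for h P Q
  proof
    have "reduced (P @ x # Q)" using u uP by (simp add: carrier_iff)
    then have "P = [] \<or> last P \<noteq> linv x" by (auto simp: reduced_append)
    then show "h \<notin> R" unfolding R_iff hP by (auto simp: hd_winv linv_eq_iff)
    have "fw_mult h u = red (x # Q)" unfolding fw_mult_def hP uP by (rule red_winv_cancel)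
    also have "\<dots> = x # Q" using \<open>reduced (P @ x # Q)\<close> by (simp add: reduced_append)
    finally show "fw_mult h u \<in> R" by (simp add: R_iff)
  qed
  have cross12: "v \<notin> R \<and> fw_mult v u \<in> R" if "v = h1 \<or> v = h2" for v
    using that cross[OF h1_def u1] cross[OF h2_def u2] by auto
  \<comment> \<open>Both jumps are steps from outside \<open>R\<close> into \<open>R\<close>; all
    other steps leave \<psi> unchanged.\<close>
  have still: "\<psi> (fw_mult v u) = \<psi> v" if "v \<in> C n" "v \<in> R \<or> fw_mult v u \<notin> R" for v
  proof -
    have "v \<noteq> h1" "v \<noteq> h2" using cross12[of v] that(2) by blast+
    then show ?thesis using eq[OF that(1)] by simp
  qed
  note far_const = far_const_cone[OF u cyc ne no_cut far] far_const_merge[OF u cyc ne no_cut far]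
  have "\<exists>c. far_const n \<psi> N (cone [] x) c"
    using x still by (intro far_const(1)[where g = "[]" and b = x and R = R]) (auto simp: R_def carrier_iff)
  then obtain c1 where "far_const n \<psi> N (cone [] x) c1" ..
  then have c1: "\<psi> w = c1" if "w \<in> C n" "N \<le> length w" "w \<in> R" for w
    using that unfolding far_const_def[OF u cyc ne no_cut far] R_def by blast
  have "\<exists>c. far_const n \<psi> N (\<Union>b\<in>Lt n - {x}. cone [] b) c"
  proof (rule far_const(2)[OF Nil_carrier x, where R = "- R"])
    fix b assume b: "b \<in> Lt n" "b \<noteq> x"
    show "\<exists>c. far_const n \<psi> N (cone [] b) c"
      using b still by (intro far_const(1)[where g = "[]" and b = b and R = "- R"]) (auto simp: R_iff cone_def carrier_iff)
  qed (use still in \<open>auto simp: R_iff cone_def\<close>)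
  then obtain c2 where "far_const n \<psi> N (\<Union>b\<in>Lt n - {x}. cone [] b) c2" ..
  \<comment> \<open>The inequality is strict because \<open>[]\<close> lies outside \<open>R\<close>
    but in no branch, and \<open>N\<close> may be 0.\<close>
  then have c2: "\<psi> w = c2" if w': "w \<in> C n" "N < length w" "w \<notin> R" for w
  proof -
    obtain b v where w: "w = b # v" using w'(2) by (cases w) auto
    then have "w \<in> (\<Union>b\<in>Lt n - {x}. cone [] b)"
      using w' by (auto simp: R_iff cone_def carrier_iff)
    then show ?thesis
      using w' \<open>far_const n \<psi> N (\<Union>b\<in>Lt n - {x}. cone [] b) c2\<close>
      unfolding far_const_def[OF u cyc ne no_cut far] by simp
  qed
  have long: "N < length (line_pos [] P Q (Suc N))" "N < length (line_neg [] P Q (Suc N))"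
    if "P @ Q = u" for P Q
    using length_line[of P Q "Suc N" "[]"] that ne by auto
  have "c1 = c2"
  proof -
    let ?P = "P3 @ [linv x]"
    have u3': "?P @ Q3 = u" using u3 by simp
    have line: "line_pos [] ?P Q3 k \<in> C n" "line_neg [] ?P Q3 k \<in> C n" for k
      using line_carrier[of ?P Q3 n "[]" k] u cyc unfolding u3' by auto
    have "turn u (linv x) (hd (Q3 @ ?P))"
      unfolding turn_def using u3' by (intro exI[of _ ?P] exI[of _ Q3]) auto
    then have "hd (Q3 @ ?P) \<noteq> x" using turn_reduced[OF cyc] by fastforce
    then have pos: "line_pos [] ?P Q3 k \<notin> R" for k
      using line_pos_cone(1)[of ?P "[]" Q3 k] by (auto simp: R_iff cone_def)
    have neg: "line_neg [] ?P Q3 k \<in> R" for k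
      using line_neg_cone[of ?P "[]" Q3 k] by (simp add: R_def)
    have "\<psi> (line_pos [] ?P Q3 (Suc N)) = \<psi> (line_neg [] ?P Q3 (Suc N))"
    proof (rule line_const[OF line])
      show "\<psi> (fw_mult (line_pos [] ?P Q3 k) (?P @ Q3)) = \<psi> (line_pos [] ?P Q3 k)" for k
        unfolding u3' using still[OF line(1)] line_step[OF line(1)] pos u3' by metis
      show "\<psi> (fw_mult (line_neg [] ?P Q3 k) (?P @ Q3)) = \<psi> (line_neg [] ?P Q3 k)" for k
        unfolding u3' using still[OF line(2)] neg by blast
    qed
    then show ?thesis using c1[OF line(2)] c2[OF line(1)] long[OF u3'] pos neg by (metis less_imp_le)
  qed
  \<comment> \<open>This line enters \<open>R\<close> only once, in the step from \<open>h1\<close>,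
    where \<psi> rises by 1; its other steps stay on one side, so the second jump is not on
    it.\<close>
  moreover have "c1 = c2 + 1"
  proof -
    let ?Q = "x # Q1"
    have u1': "P1 @ ?Q = u" using u1 by simp
    have line: "line_pos [] P1 ?Q k \<in> C n" "line_neg [] P1 ?Q k \<in> C n" for k
      using line_carrier[of P1 ?Q n "[]" k] u cyc unfolding u1' by auto
    have pos: "line_pos [] P1 ?Q k \<in> R" for k
      by (simp add: line_pos_def R_iff)
    have neg: "line_neg [] P1 ?Q k \<notin> R" for k
    proof -
      have "reduced (pw u (Suc k))" by (rule reduced_pw[OF cyc])
      then have "reduced ((pw u k @ P1) @ x # Q1)" unfolding pw_Suc2 using u1 by simp
      then have "pw u k @ P1 = [] \<or> last (pw u k @ P1) \<noteq> linv x"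
        by (subst (asm) reduced_append) auto
      then show ?thesis unfolding line_neg_def u1' R_iff append_Nil
        using hd_winv[of "pw u k @ P1"] winv_simps(6)[of "pw u k @ P1"] by (metis linv_linv)
    qed
    have "\<psi> (line_pos [] P1 ?Q j) = \<psi> (line_pos [] P1 ?Q 0)" for j
    proof (induction j)
      case (Suc j)
      have "\<psi> (fw_mult (line_pos [] P1 ?Q j) u) = \<psi> (line_pos [] P1 ?Q j)"
        using still[OF line(1)] pos by blast
      then show ?case using Suc line_step[OF line(1), of j] unfolding u1' by simp
    qed simp
    moreover have "\<psi> (line_neg [] P1 ?Q j) = \<psi> (line_neg [] P1 ?Q 0)" for j
    proof (induction j)
      case (Suc j)
      have "\<psi> (fw_mult (line_neg [] P1 ?Q (Suc j)) u) = \<psi> (line_neg [] P1 ?Q (Suc j))"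
        using still[OF line(2), of "Suc j"] line_step_neg[OF line(2), of j] neg unfolding u1' by metis
      then show ?case using Suc line_step_neg[OF line(2), of j] unfolding u1' by simp
    qed simp
    moreover have "line_neg [] P1 ?Q 0 = h1" by (simp add: line_neg_def h1_def)
    then have "\<psi> (line_pos [] P1 ?Q 0) = \<psi> (line_neg [] P1 ?Q 0) + 1"
      using eq[OF h(1)] h12 line_step_0[OF line(1)] unfolding u1' by simp
    ultimately have "\<psi> (line_pos [] P1 ?Q (Suc N)) = \<psi> (line_neg [] P1 ?Q (Suc N)) + 1" by metis
    then show ?thesis using c1[OF line(1)] c2[OF line(2)] long[OF u1'] pos neg by (metis less_imp_le)
  qed
  ultimately show False by simp
qed

lemma count_list_ge_2:
  assumes "2 \<le> count_list w x"
  shows "\<exists>P Q P' Q'. w = P @ x # Q \<and> w = P' @ x # Q' \<and> P \<noteq> P'"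
proof -
  obtain P Q where PQ: "w = P @ x # Q" "x \<notin> set P" "count_list Q x = count_list w x - 1"
    using count_list_Suc_split_first[of w x "count_list w x - 1"] assms by auto
  then have "x \<in> set Q" using assms count_list_0_iff[of Q x] by auto
  then obtain Q1 Q2 where "Q = Q1 @ x # Q2" by (auto dest: split_list)
  then have "w = (P @ x # Q1) @ x # Q2" "P \<noteq> P @ x # Q1" using PQ by auto
  then show ?thesis using PQ(1) by blast
qed

lemma exps_count: "exps i w = int (count_list w (i, False)) - int (count_list w (i, True))"
  by (induction w) (auto simp: exps_def)

lemma each_letter_once:
  assumes sep: "separating n u" and min: "aut_minimal n u"
  shows "distinct u" "set u = Lt n"
proof -
  have cyc: "cyc_reduced u" and no_cut: "no_cut_vertex n u"
    using aut_minimal_cyc_reduced[OF min] aut_minimal_no_cut_vertex[OF sep min] by auto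
  have u: "u \<in> C n" using sep by (simp add: separating_def)
  have counts: "count_list u (i, False) = count_list u (i, True)" for i
    using separating_exps[OF sep, of i] exps_count[of i u] by simp
  have le: "count_list u (i, False) \<le> 1" for i
  proof (rule ccontr)
    assume "\<not> count_list u (i, False) \<le> 1"
    then have *: "2 \<le> count_list u (i, False)" by simp
    then have "(i, True) \<in> set u" using counts count_list_0_iff[of u "(i, True)"] by auto
    then obtain P3 Q3 where "u = P3 @ linv (i, False) # Q3" by (auto dest: split_list)
    then show False using count_list_ge_2[OF *] positive_occurrence_unique[OF sep cyc no_cut] by metis
  qed
  have le: "count_list u l \<le> 1" for l
    using le[of "fst l"] counts[of "fst l"] by (cases l, cases "snd l") auto
  show "distinct u"
  proof (rule ccontr)
    assume "\<not> distinct u"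
    then obtain xs ys zs y where "u = xs @ [y] @ ys @ [y] @ zs" using not_distinct_decomp by blast
    then have "2 \<le> count_list u y" by simp
    then show False using le[of y] by simp
  qed
  have "l \<in> set u" if "l \<in> Lt n" for l
  proof -
    have "l \<in> set u \<or> linv l \<in> set u"
      using letter_or_inverse[OF separating_full_support[OF sep, of "fst l"]] that by simp
    moreover have "l \<in> set u \<longleftrightarrow> linv l \<in> set u"
      using counts[of "fst l"] count_list_0_iff[of u l] count_list_0_iff[of u "linv l"]
      by (cases l, cases "snd l") auto
    ultimately show ?thesis by blast
  qed
  then show "set u = Lt n" using u by (auto simp: carrier_iff)
qed

section \<open>Normal form of quadratic words\<close>

fun comm_word :: "letter list \<Rightarrow> word" where
  "comm_word (a # b # ls) = [a, b, linv a, linv b] @ comm_word ls"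
| "comm_word _ = []"

lemma comm_word_append: "even (length ls) \<Longrightarrow> comm_word (ls @ ks) = comm_word ls @ comm_word ks"
  by (induction ls rule: comm_word.induct) auto

lemma fst_set_comm_word: "fst ` set (comm_word ls) \<subseteq> fst ` set ls"
  by (induction ls rule: comm_word.induct) auto

lemma set_comm_word: "set ls \<subseteq> Lt n \<Longrightarrow> set (comm_word ls) \<subseteq> Lt n"
  using fst_set_comm_word[of ls] by (fastforce simp: image_iff)

lemma not_reduced_split: "\<not> reduced w \<Longrightarrow> \<exists>P l Q. w = P @ l # linv l # Q"
proof (induction w)
  case (Cons a w)
  show ?case
  proof (cases "reduced w")
    case True
    then have "w \<noteq> []" "hd w = linv a" using Cons.prems by (auto simp: reduced_Cons)
    then have "a # w = [] @ a # linv a # tl w" by (cases w) auto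
    then show ?thesis by blast
  next
    case False
    then obtain P l Q where "w = P @ l # linv l # Q" using Cons.IH by blast
    then have "a # w = (a # P) @ l # linv l # Q" by simp
    then show ?thesis by blast
  qed
qed simp

text \<open>Each generator that occurs does so once with either sign: the boundary word of a polygon
  whose sides are glued to an orientable surface.\<close>

definition quadratic :: "word \<Rightarrow> bool" where
  "quadratic w \<longleftrightarrow> distinct w \<and> linv ` set w \<subseteq> set w"

text \<open>An innermost pair \<open>a \<dots> a\<inverse>\<close> cannot enclose a pair, so it is linked with another one.\<close>

lemma linked_pair:
  assumes w: "quadratic w" "reduced w" "w = X @ x # V @ linv x # Y"
  shows "\<exists>a b A B D E F. w = A @ a # B @ b # D @ linv a # E @ linv b # F"
  using w(3)
proof (induction "length V" arbitrary: X x V Y rule: less_induct)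
  case less
  have "V \<noteq> []" using w(2) less.prems by (auto simp: reduced_append)
  then obtain b V' where V: "V = b # V'" by (cases V) auto
  have weq: "w = X @ x # b # V' @ linv x # Y" using less.prems V by simp
  have "distinct w" "linv b \<in> set w" using w(1) weq by (auto simp: quadratic_def)
  then have "linv b \<noteq> x" "linv b \<noteq> linv x" using weq by auto
  then consider "linv b \<in> set X" | "linv b \<in> set V'" | "linv b \<in> set Y"
    using \<open>linv b \<in> set w\<close> weq by auto
  then show ?case
  proof cases
    case 1
    then obtain X1 X2 where "X = X1 @ linv b # X2" by (auto dest: split_list)
    then have "w = X1 @ linv b # X2 @ x # [] @ linv (linv b) # V' @ linv x # Y" using weq by simp
    then show ?thesis by blast
  next
    case 2
    then obtain V1 V2 where V': "V' = V1 @ linv b # V2" by (auto dest: split_list)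
    then have "w = (X @ [x]) @ b # V1 @ linv b # V2 @ linv x # Y" using weq by simp
    moreover have "length V1 < length V" using V V' by simp
    ultimately show ?thesis using less.hyps by blast
  next
    case 3
    then obtain Y1 Y2 where "Y = Y1 @ linv b # Y2" by (auto dest: split_list)
    then have "w = X @ x # [] @ b # V' @ linv x # Y1 @ linv b # Y2" using weq by simp
    then show ?thesis by blast
  qed
qed

lemma subst_elem:
  assumes "ok_subst n (elem_subst a P Q)"
  shows "subst (elem_subst a P Q) (red w) = red (concat (map (elem_subst a P Q) w))"
  using subst_red[of "elem_subst a P Q" w] ok_substD(1)[OF assms] by (simp add: subst_def)

text \<open>Cutting and regluing to split off a handle, as three substitutions. The first absorbs
  \<open>A\<close> and \<open>B\<close> into \<open>a\<close>. In the second, the factor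
  \<open>winv (D @ B)\<close> brings \<open>D @ B\<close> behind \<open>A @ E\<close>, which makes
  up \<open>G\<close> between \<open>linv a\<close> and \<open>linv b\<close>, and conjugation by
  \<open>G\<close> moves it past \<open>linv b\<close>. The third strips \<open>winv G\<close> and
  \<open>G\<close> from the two sides of \<open>b\<close>.\<close>

lemma quadratic_collect:
  assumes Lt: "set (X @ A @ a # B @ b # D @ linv a # E @ linv b # F) \<subseteq> Lt n"
    and a: "fst a \<notin> fst ` set (X @ A @ B @ D @ E @ F)"
    and b: "fst b \<notin> fst ` set (X @ A @ B @ D @ E @ F)"
    and ab: "fst a \<noteq> fst b"
  shows "\<exists>\<phi>\<in>iso (free_grp n) (free_grp n). \<phi> (red (X @ A @ a # B @ b # D @ linv a # E @ linv b # F))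
     = red (X @ [a, b, linv a, linv b] @ A @ E @ D @ B @ F)"
proof -
  have fst_winv: "fst ` set (winv w) = fst ` set w" for w
    by (force simp: set_winv image_image)
  have Lt_winv: "set (winv w) \<subseteq> Lt n" if "set w \<subseteq> Lt n" for w
    using that by (auto simp: set_winv)
  define G where "G = A @ E @ D @ B"
  define s1 where "s1 = elem_subst a (winv A) (winv B)"
  define s2 where "s2 = elem_subst b (winv G) (G @ winv (D @ B))"
  define s3 where "s3 = elem_subst a [] G"
  have ab': "a \<noteq> b" "b \<noteq> a" "a \<noteq> linv b" "b \<noteq> linv a" "linv a \<noteq> b" "linv b \<noteq> a"
    using ab by auto
  have G: "set G \<subseteq> Lt n" "fst a \<notin> fst ` set G" "fst b \<notin> fst ` set G"
    using Lt a b by (auto simp: G_def simp del: split_paired_All)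
  have DB: "set (winv (D @ B)) \<subseteq> Lt n" "fst b \<notin> fst ` set (winv (D @ B))"
    using Lt b Lt_winv[of "D @ B"] unfolding fst_winv by (auto simp del: winv_simps(3))
  have ok1: "ok_subst n s1" and iso1: "subst s1 \<in> iso (free_grp n) (free_grp n)"
  proof -
    have "a \<in> Lt n" "set (winv A) \<subseteq> Lt n" "set (winv B) \<subseteq> Lt n"
      "fst a \<notin> fst ` set (winv A)" "fst a \<notin> fst ` set (winv B)"
      using Lt a Lt_winv[of A] Lt_winv[of B] unfolding set_append image_Un fst_winv by auto
    note * = this
    show "ok_subst n s1" unfolding s1_def by (rule elem_subst_ok[OF *(1-3)])
    show "subst s1 \<in> iso (free_grp n) (free_grp n)" unfolding s1_def by (rule elem_subst_iso[OF *])
  qed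
  have ok2: "ok_subst n s2" and iso2: "subst s2 \<in> iso (free_grp n) (free_grp n)"
  proof -
    have "b \<in> Lt n" "set (winv G) \<subseteq> Lt n" "set (G @ winv (D @ B)) \<subseteq> Lt n"
      "fst b \<notin> fst ` set (winv G)" "fst b \<notin> fst ` set (G @ winv (D @ B))"
      using Lt G DB Lt_winv[of G] unfolding set_append image_Un fst_winv by auto
    note * = this
    show "ok_subst n s2" unfolding s2_def by (rule elem_subst_ok[OF *(1-3)])
    show "subst s2 \<in> iso (free_grp n) (free_grp n)" unfolding s2_def by (rule elem_subst_iso[OF *])
  qed
  have ok3: "ok_subst n s3" and iso3: "subst s3 \<in> iso (free_grp n) (free_grp n)"
    unfolding s3_def using Lt G by (auto intro!: elem_subst_ok elem_subst_iso)
  have S1: "subst s1 (red w) = red (concat (map s1 w))" for w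
    using ok1 unfolding s1_def by (rule subst_elem)
  have S2: "subst s2 (red w) = red (concat (map s2 w))" for w
    using ok2 unfolding s2_def by (rule subst_elem)
  have S3: "subst s3 (red w) = red (concat (map s3 w))" for w
    using ok3 unfolding s3_def by (rule subst_elem)
  have fix1: "concat (map s1 w) = w" if "fst a \<notin> fst ` set w" for w
    using subst_elem_fix[OF that] by (simp add: s1_def)
  have fix2: "concat (map s2 w) = w" if "fst b \<notin> fst ` set w" for w
    using subst_elem_fix[OF that] by (simp add: s2_def)
  have fix3: "concat (map s3 w) = w" if "fst a \<notin> fst ` set w" for w
    using subst_elem_fix[OF that] by (simp add: s3_def)
  have s1: "s1 a = winv A @ [a] @ winv B" "s1 (linv a) = B @ [linv a] @ A" "s1 b = [b]" "s1 (linv b) = [linv b]"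
    using ab' by (auto simp: s1_def elem_subst_def)
  have s2: "s2 b = winv G @ [b] @ G @ winv (D @ B)" "s2 (linv b) = D @ B @ winv G @ [linv b] @ G"
    "s2 a = [a]" "s2 (linv a) = [linv a]"
    using ab' by (auto simp: s2_def elem_subst_def)
  have s3: "s3 a = a # G" "s3 (linv a) = winv G @ [linv a]" "s3 b = [b]" "s3 (linv b) = [linv b]"
    using ab' by (auto simp: s3_def elem_subst_def)
  have fix1': "concat (map s1 w) = w" if "w \<in> {X, A, B, D, E, F}" for w
    using that a by (intro fix1) auto
  have fix2': "concat (map s2 w) = w" if "w \<in> {X, A, B, D, E, F}" for w
    using that b by (intro fix2) auto
  have fix3': "concat (map s3 w) = w" if "w \<in> {X, A, B, D, E, F, G, winv G}" for w
  proof (rule fix3)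
    have "fst a \<notin> fst ` set (winv G)" using G(2) unfolding fst_winv .
    then show "fst a \<notin> fst ` set w" using that a G(2) by auto
  qed
  have "subst s1 (red (X @ A @ a # B @ b # D @ linv a # E @ linv b # F))
      = red (X @ A @ winv A @ a # winv B @ B @ b # D @ B @ linv a # A @ E @ linv b # F)"
    by (simp add: S1 s1 fix1')
  also have "\<dots> = red (X @ a # b # D @ B @ linv a # A @ E @ linv b # F)"
    by (simp add: word_simps)
  finally have 1: "subst s1 (red (X @ A @ a # B @ b # D @ linv a # E @ linv b # F))
      = red (X @ a # b # D @ B @ linv a # A @ E @ linv b # F)" .
  have "subst s2 (red (X @ a # b # D @ B @ linv a # A @ E @ linv b # F))
      = red (X @ a # winv G @ b # G @ winv (D @ B) @ D @ B @ linv a # A @ E @ D @ B @ winv G @ linv b # G @ F)"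
    by (simp add: S2 s2 fix2')
  also have "\<dots> = red (X @ a # winv G @ b # G @ linv a # linv b # G @ F)"
    by (simp add: G_def word_simps)
  finally have 2: "subst s2 (red (X @ a # b # D @ B @ linv a # A @ E @ linv b # F))
      = red (X @ a # winv G @ b # G @ linv a # linv b # G @ F)" .
  have "subst s3 (red (X @ a # winv G @ b # G @ linv a # linv b # G @ F))
      = red (X @ a # G @ winv G @ b # G @ winv G @ linv a # linv b # G @ F)"
    by (simp add: S3 s3 fix3')
  also have "\<dots> = red (X @ a # b # linv a # linv b # G @ F)"
    by (simp add: word_simps)
  finally have 3: "subst s3 (red (X @ a # winv G @ b # G @ linv a # linv b # G @ F))
      = red (X @ a # b # linv a # linv b # G @ F)" .
  have "(subst s3 \<circ> (subst s2 \<circ> subst s1)) (red (X @ A @ a # B @ b # D @ linv a # E @ linv b # F))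
     = red (X @ [a, b, linv a, linv b] @ A @ E @ D @ B @ F)"
    by (simp add: 1 2 3) (simp add: G_def)
  moreover have "subst s3 \<circ> (subst s2 \<circ> subst s1) \<in> iso (free_grp n) (free_grp n)"
    using iso1 iso2 iso3 iso_set_trans by blast
  ultimately show ?thesis by blast
qed

definition normal_list :: "nat \<Rightarrow> letter list \<Rightarrow> bool" where
  "normal_list n ls \<longleftrightarrow> set ls \<subseteq> Lt n \<and> distinct (map fst ls) \<and> even (length ls)"

lemma iso_refl: "(\<lambda>x. x) \<in> iso (free_grp n) (free_grp n)"
  by (auto simp: iso_def hom_def bij_betw_def)

text \<open>The finished commutators are carried along in \<open>ls\<close>, as each automorphism
  acts on the whole word; it fixes them because they share no generator with \<open>w\<close>.
  Cancelling pairs may lose generators, so the length of \<open>ls'\<close> stays open here.\<close>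

lemma quadratic_normal_form:
  assumes "normal_list n ls" "quadratic w" "set w \<subseteq> Lt n" "fst ` set w \<inter> fst ` set ls = {}"
  shows "\<exists>\<phi>\<in>iso (free_grp n) (free_grp n). \<exists>ls'. normal_list n ls' \<and>
    \<phi> (red (comm_word ls @ w)) = red (comm_word ls')"
  using assms
proof (induction "length w" arbitrary: ls w rule: less_induct)
  case less
  note ls = less.prems(1) and w = less.prems(2-4)
  show ?case
  proof (cases "w = []")
    case True
    then show ?thesis using iso_refl ls by auto
  next
    case ne: False
    show ?thesis
    proof (cases "reduced w")
      case False
      then obtain P l Q where wP: "w = P @ l # linv l # Q" using not_reduced_split by blast
      have "quadratic (P @ Q)" using w(1) by (fastforce simp: wP quadratic_def image_subset_iff)
      moreover have "set (P @ Q) \<subseteq> Lt n" "fst ` set (P @ Q) \<inter> fst ` set ls = {}"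
        using w(2,3) by (auto simp: wP)
      moreover have "length (P @ Q) < length w" by (simp add: wP)
      ultimately have "\<exists>\<phi>\<in>iso (free_grp n) (free_grp n). \<exists>ls'. normal_list n ls' \<and>
          \<phi> (red (comm_word ls @ P @ Q)) = red (comm_word ls')"
        using less.hyps ls by blast
      moreover have "red (comm_word ls @ w) = red (comm_word ls @ P @ Q)"
        unfolding wP by (intro red_cong_right) simp
      ultimately show ?thesis by simp
    next
      case True
      obtain x w' where x: "w = x # w'" using ne by (cases w) auto
      then have "linv x \<in> set w'" using w(1) by (auto simp: quadratic_def)
      then obtain V Y where "w' = V @ linv x # Y" by (auto dest: split_list)
      then have "w = [] @ x # V @ linv x # Y" using x by simp
      then obtain a b A B D E F where wA: "w = A @ a # B @ b # D @ linv a # E @ linv b # F"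
        using linked_pair[OF w(1) True] by blast
      have dist: "distinct w" using w(1) by (simp add: quadratic_def)
      have nota: "fst a \<notin> fst ` set (A @ B @ D @ E @ F)"
      proof
        assume "fst a \<in> fst ` set (A @ B @ D @ E @ F)"
        then have "a \<in> set (A @ B @ D @ E @ F) \<or> linv a \<in> set (A @ B @ D @ E @ F)"
          by (rule letter_or_inverse)
        then show False using dist unfolding wA by auto
      qed
      have notb: "fst b \<notin> fst ` set (A @ B @ D @ E @ F)"
      proof
        assume "fst b \<in> fst ` set (A @ B @ D @ E @ F)"
        then have "b \<in> set (A @ B @ D @ E @ F) \<or> linv b \<in> set (A @ B @ D @ E @ F)"
          by (rule letter_or_inverse)
        then show False using dist unfolding wA by auto
      qed
      have ab: "fst a \<noteq> fst b"
        using dist unfolding fst_eq_iff wA by auto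
      have X: "fst ` set (comm_word ls) \<inter> fst ` set w = {}"
        using fst_set_comm_word[of ls] w(3) by blast
      have abw: "a \<in> set w" "b \<in> set w" by (simp_all add: wA)
      have sub: "set (A @ E @ D @ B @ F) \<subseteq> set w" by (auto simp: wA)
      have "\<exists>\<phi>\<in>iso (free_grp n) (free_grp n). \<phi> (red (comm_word ls @ A @ a # B @ b # D @ linv a # E @ linv b # F))
         = red (comm_word ls @ [a, b, linv a, linv b] @ A @ E @ D @ B @ F)"
      proof (rule quadratic_collect[OF _ _ _ ab])
        show "set (comm_word ls @ A @ a # B @ b # D @ linv a # E @ linv b # F) \<subseteq> Lt n"
          using w(2) ls set_comm_word[of ls n] unfolding normal_list_def wA by auto
        show "fst a \<notin> fst ` set (comm_word ls @ A @ B @ D @ E @ F)"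
          using nota X abw unfolding set_append image_Un by blast
        show "fst b \<notin> fst ` set (comm_word ls @ A @ B @ D @ E @ F)"
          using notb X abw unfolding set_append image_Un by blast
      qed
      then obtain \<phi> where \<phi>: "\<phi> \<in> iso (free_grp n) (free_grp n)"
        "\<phi> (red (comm_word ls @ w)) = red (comm_word ls @ [a, b, linv a, linv b] @ A @ E @ D @ B @ F)"
        unfolding wA by blast
      have ls': "normal_list n (ls @ [a, b])"
        using ls w(2,3) abw ab by (auto simp: normal_list_def)
      have "quadratic (A @ E @ D @ B @ F)"
      proof -
        have closed: "linv l \<in> set (A @ E @ D @ B @ F)" if l: "l \<in> set (A @ E @ D @ B @ F)" for l
        proof -
          have "linv l \<in> set w" using l w(1) sub unfolding quadratic_def by blast
          moreover have "fst l \<noteq> fst a" "fst l \<noteq> fst b"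
            using image_eqI[OF refl l, of fst] nota notb by (auto simp only: set_append Un_ac)
          then have "linv l \<noteq> a" "linv l \<noteq> linv a" "linv l \<noteq> b" "linv l \<noteq> linv b"
            by (metis fst_linv)+
          ultimately show ?thesis unfolding wA by auto
        qed
        have "distinct (A @ E @ D @ B @ F)" using dist unfolding wA by auto
        then show ?thesis unfolding quadratic_def by (intro conjI image_subsetI closed)
      qed
      moreover have "set (A @ E @ D @ B @ F) \<subseteq> Lt n" using sub w(2) by blast
      moreover have "fst ` set (A @ E @ D @ B @ F) \<inter> fst ` set (ls @ [a, b]) = {}"
      proof -
        have *: "M \<inter> (L \<union> {x, y}) = {}" if "M \<subseteq> W" "W \<inter> L = {}" "x \<notin> M" "y \<notin> M"
          for M W L :: "nat set" and x y
          using that by blast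
        have "fst a \<notin> fst ` set (A @ E @ D @ B @ F)" "fst b \<notin> fst ` set (A @ E @ D @ B @ F)"
          using nota notb unfolding set_append image_Un by blast+
        with *[OF image_mono[OF sub] w(3)]
        have "fst ` set (A @ E @ D @ B @ F) \<inter> (fst ` set ls \<union> {fst a, fst b}) = {}" .
        moreover have "fst ` set (ls @ [a, b]) = fst ` set ls \<union> {fst a, fst b}" by auto
        ultimately show ?thesis by (simp only:)
      qed
      moreover have "length (A @ E @ D @ B @ F) < length w" by (simp add: wA)
      ultimately obtain \<chi> ls' where \<chi>: "\<chi> \<in> iso (free_grp n) (free_grp n)" "normal_list n ls'"
        "\<chi> (red (comm_word (ls @ [a, b]) @ A @ E @ D @ B @ F)) = red (comm_word ls')"
        using less.hyps ls' by blast
      have "comm_word (ls @ [a, b]) = comm_word ls @ [a, b, linv a, linv b]"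
        using ls comm_word_append[of ls "[a, b]"] by (simp add: normal_list_def)
      then have "(\<chi> \<circ> \<phi>) (red (comm_word ls @ w)) = red (comm_word ls')"
        using \<phi>(2) \<chi>(3) by simp
      moreover have "\<chi> \<circ> \<phi> \<in> iso (free_grp n) (free_grp n)"
        using \<phi>(1) \<chi>(1) iso_set_trans by blast
      ultimately show ?thesis using \<chi>(2) by blast
    qed
  qed
qed

section \<open>From products of commutators to the surface word\<close>

lemma letter_bij_iso:
  assumes bij: "bij \<tau>" and linv: "\<And>l. \<tau> (linv l) = linv (\<tau> l)" and Lt: "\<And>l. \<tau> l \<in> Lt n \<longleftrightarrow> l \<in> Lt n"
  shows "ok_subst n (\<lambda>l. [\<tau> l])" "subst (\<lambda>l. [\<tau> l]) \<in> iso (free_grp n) (free_grp n)"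
proof -
  define \<sigma> where "\<sigma> = inv_into UNIV \<tau>"
  have inv: "\<sigma> (\<tau> l) = l" "\<tau> (\<sigma> l) = l" for l
    using bij by (simp_all add: \<sigma>_def bij_is_inj bij_is_surj surj_f_inv_f)
  have inv_linv: "\<sigma> (linv l) = linv (\<sigma> l)" for l
    by (metis inv linv)
  have inv_Lt: "\<sigma> l \<in> Lt n \<longleftrightarrow> l \<in> Lt n" for l
    by (metis inv(2) Lt)
  show ok: "ok_subst n (\<lambda>l. [\<tau> l])"
    using linv Lt by (simp add: ok_subst_def del: split_paired_All)
  have ok': "ok_subst n (\<lambda>l. [\<sigma> l])"
    using inv_linv inv_Lt by (simp add: ok_subst_def del: split_paired_All)
  show "subst (\<lambda>l. [\<tau> l]) \<in> iso (free_grp n) (free_grp n)"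
    by (rule subst_iso[OF ok ok']) (simp_all add: subst_def inv)
qed

lemma surface_word_image:
  assumes ls: "normal_list n ls" "length ls = n" and m: "n = 2 * m"
  shows "\<exists>\<theta>\<in>iso (free_grp n) (free_grp n). \<theta> (surface_word m) = red (comm_word ls)"
proof -
  \<comment> \<open>\<open>fw_comm\<close> has the inverses in front and \<open>comm_word\<close>
    has them behind, so generators go to inverses of the letters in \<open>ls\<close>. Letters out
    of range are fixed to make \<tau> a bijection of all letters.\<close>
  define \<tau> where "\<tau> l = (if fst l < n then (if snd l then ls ! fst l else linv (ls ! fst l)) else l)" for l :: letter
  have Lt: "\<tau> l \<in> Lt n \<longleftrightarrow> l \<in> Lt n" for l
    using ls nth_mem[of "fst l" ls] by (auto simp: \<tau>_def normal_list_def simp del: nth_mem)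
  have \<tau>_linv: "\<tau> (linv l) = linv (\<tau> l)" for l by (auto simp: \<tau>_def)
  have inj: "inj \<tau>"
  proof (rule injI)
    fix k l assume eq: "\<tau> k = \<tau> l"
    show "k = l"
    proof (cases "k \<in> Lt n")
      case False
      then have "l \<notin> Lt n" using Lt[of k] Lt[of l] eq by simp
      then show ?thesis using False eq by (simp add: \<tau>_def)
    next
      case True
      then have l: "l \<in> Lt n" using Lt[of k] Lt[of l] eq by simp
      have "map fst ls ! fst k = map fst ls ! fst l"
        using arg_cong[OF eq, of fst] True l ls(2) by (simp add: \<tau>_def split: if_splits)
      then have fst: "fst k = fst l"
        using ls True l nth_eq_iff_index_eq[of "map fst ls"] by (simp add: normal_list_def)
      have "snd k = snd l"
        using eq True l fst by (auto simp: \<tau>_def split: if_splits)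
      then show ?thesis using fst by (simp add: prod_eq_iff)
    qed
  qed
  have "\<exists>k. l = \<tau> k" for l
  proof (cases "l \<in> Lt n")
    case False
    then show ?thesis by (intro exI[of _ l]) (simp add: \<tau>_def)
  next
    case True
    have "Lt n = {..<n} \<times> UNIV" by auto
    then have "finite (Lt n)" by simp
    moreover have "\<tau> ` Lt n \<subseteq> Lt n" using Lt by blast
    ultimately have "\<tau> ` Lt n = Lt n"
      using inj by (intro endo_inj_surj) (auto intro: inj_on_subset)
    then show ?thesis using True by blast
  qed
  then have "bij \<tau>" using inj by (simp add: bij_def surj_def del: split_paired_All split_paired_Ex)
  note \<theta> = letter_bij_iso[OF \<open>bij \<tau>\<close> \<tau>_linv Lt]
  let ?s = "\<lambda>l. [\<tau> l]"
  have "subst ?s (surface_word k) = red (comm_word (take (2 * k) ls))" if "k \<le> m" for k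
    using that
  proof (induction k)
    case 0
    then show ?case by (simp add: subst_def)
  next
    case (Suc k)
    let ?a = "ls ! (2 * k)" and ?b = "ls ! (2 * k + 1)"
    have len: "2 * k + 1 < length ls" using Suc.prems ls(2) m by simp
    then have "take (2 * Suc k) ls = take (2 * k) ls @ [?a, ?b]"
      by (simp add: take_Suc_conv_app_nth)
    moreover have "even (length (take (2 * k) ls))" using len by simp
    ultimately have R: "comm_word (take (2 * Suc k) ls) = comm_word (take (2 * k) ls) @ [?a, ?b, linv ?a, linv ?b]"
      by (simp only: comm_word_append) simp
    have \<tau>: "\<tau> (2 * k, True) = ?a" "\<tau> (2 * k, False) = linv ?a"
      "\<tau> (2 * k + 1, True) = ?b" "\<tau> (2 * k + 1, False) = linv ?b"
      using len ls(2) by (auto simp: \<tau>_def)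
    have "subst ?s (surface_word (Suc k)) = fw_mult (subst ?s (surface_word k)) (red [?a, ?b, linv ?a, linv ?b])"
      using \<tau> by (simp add: subst_mult[OF \<theta>(1)] fw_comm_def fw_inv_eq gen_def) (simp add: subst_def fw_mult_def)
    also have "\<dots> = red (comm_word (take (2 * Suc k) ls))"
      using Suc unfolding R by (simp add: fw_mult_def)
    finally show ?case .
  qed
  from this[of m] have "subst ?s (surface_word m) = red (comm_word ls)" using ls(2) m by simp
  then show ?thesis using \<theta>(2) by blast
qed

theorem theorem1p2:
  fixes m :: nat and u :: word
  assumes "m \<ge> 1"
    and "u \<in> carrier (free_grp (2 * m))"
    and "Delta_primitive (2 * m) u"
  shows "\<exists>\<phi> \<in> iso (free_grp (2 * m)) (free_grp (2 * m)). \<phi> (surface_word m) = u"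
proof -
  define n where "n = 2 * m"
  let ?Aut = "iso (free_grp n) (free_grp n)"
  have u: "u \<in> C n" using assms(2) by (simp add: n_def)
  have sep: "separating n u" using Delta_primitive_separating assms(3) by (simp add: n_def)
  define \<alpha> where "\<alpha> = (ARG_MIN (\<lambda>\<phi>. length (\<phi> u)) \<phi>. \<phi> \<in> ?Aut)"
  have \<alpha>: "\<alpha> \<in> ?Aut" and least: "\<And>\<phi>. \<phi> \<in> ?Aut \<Longrightarrow> length (\<alpha> u) \<le> length (\<phi> u)"
    using arg_min_nat_lemma[of "\<lambda>\<phi>. \<phi> \<in> ?Aut" "\<lambda>x. x" "\<lambda>\<phi>. length (\<phi> u)"] iso_refl[of n]
    by (auto simp: \<alpha>_def)
  define v where "v = \<alpha> u"
  have v: "separating n v" using separating_iso[OF sep \<alpha>] by (simp add: v_def)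
  have "length v \<le> length (\<phi> v)" if "\<phi> \<in> ?Aut" for \<phi>
    using least[of "\<phi> \<circ> \<alpha>"] that \<alpha> iso_set_trans[of \<alpha> "free_grp n" "free_grp n" \<phi> "free_grp n"]
    by (simp add: v_def)
  then have "aut_minimal n v" using v by (auto simp: aut_minimal_def separating_def)
  then have letters: "distinct v" "set v = Lt n" using each_letter_once[OF v] by auto
  have vC: "v \<in> C n" using v by (simp add: separating_def)
  have "quadratic v" using letters by (simp add: quadratic_def image_subset_iff)
  then obtain \<beta> ls where \<beta>: "\<beta> \<in> ?Aut" and ls: "normal_list n ls" and "\<beta> (red (comm_word [] @ v)) = red (comm_word ls)"
    using quadratic_normal_form[of n "[]" v] letters(2) by (auto simp: normal_list_def)
  then have \<beta>v: "\<beta> v = red (comm_word ls)" using vC by (simp add: carrier_iff)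
  \<comment> \<open>\<open>\<beta> v\<close> is again separating, so it involves every generator:
    the reduction has lost none, and \<open>ls\<close> has one letter for each.\<close>
  have "{..<n} \<subseteq> fst ` set ls"
  proof
    fix i assume "i \<in> {..<n}"
    then have "i \<in> fst ` set (red (comm_word ls))"
      using separating_full_support[OF separating_iso[OF v \<beta>]] by (simp add: \<beta>v)
    then show "i \<in> fst ` set ls" using set_red[of "comm_word ls"] fst_set_comm_word[of ls] by blast
  qed
  then have "set (map fst ls) = {..<n}" using ls by (auto simp: normal_list_def)
  then have "length ls = n"
    using ls distinct_card[of "map fst ls"] by (simp add: normal_list_def)
  then obtain \<theta> where \<theta>: "\<theta> \<in> ?Aut" "\<theta> (surface_word m) = red (comm_word ls)"
    using surface_word_image[OF ls _ n_def] by blast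
  define \<gamma> where "\<gamma> = inv_into (C n) (\<beta> \<circ> \<alpha>)"
  have \<beta>\<alpha>: "\<beta> \<circ> \<alpha> \<in> ?Aut" using \<alpha> \<beta> iso_set_trans by blast
  then have \<gamma>: "\<gamma> \<in> ?Aut" unfolding \<gamma>_def using group.iso_set_sym[OF group_free_grp] by blast
  have "inj_on (\<beta> \<circ> \<alpha>) (C n)" using \<beta>\<alpha> by (auto simp: iso_def bij_betw_def)
  then have "\<gamma> ((\<beta> \<circ> \<alpha>) u) = u" unfolding \<gamma>_def using u by (rule inv_into_f_f)
  then have "(\<gamma> \<circ> \<theta>) (surface_word m) = u" using \<theta>(2) \<beta>v by (simp add: v_def)
  moreover have "\<gamma> \<circ> \<theta> \<in> ?Aut" using \<gamma> \<theta>(1) iso_set_trans by blast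
  ultimately show ?thesis unfolding n_def by blast
qed

end
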